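(* Let $A=A_s+A_d\epsilon\in\mathbb{D}^{m\times n}$. Then $A^G=A^P$ if and only if $$(A_sA_s^+)A_d(I_n-A_s^+A_s)=O\quad\text{and}\quad(I_m-A_sA_s^+)A_d(A_s^+A_s)=O.$$ Moreover, setting $A_2=A-(A_sA_s^+)A_d(I_n-A_s^+A_s)\epsilon-(I_m-A_sA_s^+)A_d(A_s^+A_s)\epsilon$, one has $A^P=A_2^G$.
   Context: A dual real matrix is $A=A_s+A_d\epsilon$ with real matrices $A_s,A_d$, $\epsilon\neq0$, $\epsilon^2=0$; $A^\top=A_s^\top+A_d^\top\epsilon$. $A_s^+$ is the Moore–Penrose inverse of $A_s$. The MPDGI is $A^P=A_s^+-A_s^+A_dA_s^+\epsilon$. Every dual real matrix $B$ has an SVD $B=U\Sigma V^\top$ with $U,V$ orthogonal dual real and $\Sigma$ diagonal with entries $\mu_1\ge\dots\ge\mu_r$ positive appreciable (nonzero standard part), $\mu_{r+1}\ge\dots\ge\mu_t$ positive infinitesimal (zero standard part), and zeros (order on dual reals: $a>b$ iff $a_s>b_s$, or $a_s=b_s$ and $a_d>b_d$); the essential part is $B_e=U\begin{bmatrix}\mathrm{diag}(\mu_1,\dots,\mu_r)&O\\O&O\end{bmatrix}V^\top$, and the GMPI $B^G$ is the unique $X$ with $BXB=B_e$, $XBX=X$, $(BX)^\top=BX$, $(XB)^\top=XB$. *)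

theory Defs
  imports "Jordan_Normal_Form.Matrix"
begin

definition mp_inv :: "real mat \<Rightarrow> real mat" where
  "mp_inv A = (THE X. X \<in> carrier_mat (dim_col A) (dim_row A) \<and>
      A * X * A = A \<and> X * A * X = X \<and>
      transpose_mat (A * X) = A * X \<and> transpose_mat (X * A) = X * A)"

text \<open>A dual real number a_s + a_d eps is the pair (a_s, a_d);
  a dual real matrix A_s + A_d eps is the pair (A_s, A_d) of real matrices
  of equal dimensions.\<close>

type_synonym dual = "real \<times> real"
type_synonym dmat = "real mat \<times> real mat"

definition dual_less :: "dual \<Rightarrow> dual \<Rightarrow> bool" where
  "dual_less b a \<longleftrightarrow> fst a > fst b \<or> (fst a = fst b \<and> snd a > snd b)"

definition dual_le :: "dual \<Rightarrow> dual \<Rightarrow> bool" where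
  "dual_le b a \<longleftrightarrow> dual_less b a \<or> a = b"

definition dmult :: "dmat \<Rightarrow> dmat \<Rightarrow> dmat" where
  "dmult A B = (fst A * fst B, fst A * snd B + snd A * fst B)"

definition dtrans :: "dmat \<Rightarrow> dmat" where
  "dtrans A = (transpose_mat (fst A), transpose_mat (snd A))"

definition done_mat :: "nat \<Rightarrow> dmat" where
  "done_mat k = (1\<^sub>m k, 0\<^sub>m k k)"

definition dcarrier :: "nat \<Rightarrow> nat \<Rightarrow> dmat set" where
  "dcarrier m n = {A. fst A \<in> carrier_mat m n \<and> snd A \<in> carrier_mat m n}"

definition dorthogonal :: "nat \<Rightarrow> dmat \<Rightarrow> bool" where
  "dorthogonal k U \<longleftrightarrow> U \<in> dcarrier k k \<and>
     dmult (dtrans U) U = done_mat k \<and> dmult U (dtrans U) = done_mat k"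

definition dentry :: "dmat \<Rightarrow> nat \<Rightarrow> nat \<Rightarrow> dual" where
  "dentry S i j = (fst S $$ (i, j), snd S $$ (i, j))"

definition svd_sigma :: "nat \<Rightarrow> nat \<Rightarrow> nat \<Rightarrow> nat \<Rightarrow> dmat \<Rightarrow> bool" where
  "svd_sigma m n r t S \<longleftrightarrow> S \<in> dcarrier m n \<and> r \<le> t \<and> t \<le> min m n \<and>
     (\<forall>i<m. \<forall>j<n. i \<noteq> j \<longrightarrow> dentry S i j = (0, 0)) \<and>
     (\<forall>i<r. fst (dentry S i i) > 0) \<and>
     (\<forall>i. r \<le> i \<and> i < t \<longrightarrow> fst (dentry S i i) = 0 \<and> snd (dentry S i i) > 0) \<and>
     (\<forall>i. t \<le> i \<and> i < min m n \<longrightarrow> dentry S i i = (0, 0)) \<and>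
     (\<forall>i j. i \<le> j \<and> j < t \<longrightarrow> dual_le (dentry S j j) (dentry S i i))"

definition dtrunc :: "nat \<Rightarrow> dmat \<Rightarrow> dmat" where
  "dtrunc r S =
     (mat (dim_row (fst S)) (dim_col (fst S)) (\<lambda>(i, j). if i = j \<and> i < r then fst S $$ (i, j) else 0),
      mat (dim_row (snd S)) (dim_col (snd S)) (\<lambda>(i, j). if i = j \<and> i < r then snd S $$ (i, j) else 0))"

definition dual_svd :: "nat \<Rightarrow> nat \<Rightarrow> dmat \<Rightarrow> dmat \<Rightarrow> dmat \<Rightarrow> dmat \<Rightarrow> nat \<Rightarrow> nat \<Rightarrow> bool" where
  "dual_svd m n B U S V r t \<longleftrightarrow> B \<in> dcarrier m n \<and> dorthogonal m U \<and> dorthogonal n V \<and>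
     svd_sigma m n r t S \<and> B = dmult (dmult U S) (dtrans V)"

definition ess_part :: "dmat \<Rightarrow> dmat" where
  "ess_part B = (THE E. \<exists>U S V r t. dual_svd (dim_row (fst B)) (dim_col (fst B)) B U S V r t \<and>
       E = dmult (dmult U (dtrunc r S)) (dtrans V))"

definition gmpi :: "dmat \<Rightarrow> dmat" where
  "gmpi B = (THE X. X \<in> dcarrier (dim_col (fst B)) (dim_row (fst B)) \<and>
     dmult (dmult B X) B = ess_part B \<and> dmult (dmult X B) X = X \<and>
     dtrans (dmult B X) = dmult B X \<and> dtrans (dmult X B) = dmult X B)"

definition mpdgi :: "dmat \<Rightarrow> dmat" where
  "mpdgi A = (mp_inv (fst A), - (mp_inv (fst A) * snd A * mp_inv (fst A)))"

end

theory Submission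
  imports Defs "HOL-Analysis.Function_Topology" "Jordan_Normal_Form.Determinant"
begin

text \<open>
  The substance is that \<open>ess_part\<close> and \<open>gmpi\<close>, which are definite descriptions, denote what they
  should; this requires a dual singular value decomposition of every dual matrix. It is obtained by
  maximising, over pairs of real orthogonal matrices \<open>(U, V)\<close>, first the trace of \<open>U\<^sup>T B\<^sub>s V\<close> and then,
  among the maximisers, the trace of \<open>U\<^sup>T B\<^sub>d V\<close>, both taken with strictly decreasing positive
  weights on the diagonal. Comparing an optimal pair with plane rotations and sign changes shows that
  \<open>C = U\<^sup>T B\<^sub>s V\<close> is diagonal, nonnegative and decreasing, and that \<open>M = U\<^sup>T B\<^sub>d V\<close> has no
  symmetric off-diagonal part on the blocks where \<open>C\<close> is constant and no off-diagonal part at all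
  where \<open>C\<close> vanishes; the remaining off-diagonal part is removed by infinitesimal rotations
  \<open>U (I + K \<epsilon>)\<close> and \<open>V (I + L \<epsilon>)\<close> with \<open>K\<close> and \<open>L\<close> skew-symmetric.

  With \<open>P = A\<^sub>s A\<^sub>s\<^sup>+\<close> and \<open>Q = A\<^sub>s\<^sup>+ A\<^sub>s\<close> the essential part is \<open>A\<^sub>s + (P A\<^sub>d + A\<^sub>d Q - P A\<^sub>d Q) \<epsilon>\<close>.
  The infinitesimal parts of \<open>A A\<^sup>P\<close> and \<open>A\<^sup>P A\<close> are \<open>(I - P) A\<^sub>d A\<^sub>s\<^sup>+\<close> and \<open>A\<^sub>s\<^sup>+ A\<^sub>d (I - Q)\<close>;
  they can be symmetric only if they vanish, which is the stated condition.
\<close>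

section \<open>Lexicographic optimisation over the orthogonal group\<close>

lemma mat_assoc_dim:
  fixes A B C :: "'a::semiring_0 mat"
  assumes "dim_col A = dim_row B" "dim_col B = dim_row C"
  shows "A * B * C = A * (B * C)"
  by (rule assoc_mult_mat[of A "dim_row A" "dim_row B" B "dim_row C" C "dim_col C"])
    (use assms in auto)

lemma mat_add_mult_dim:
  fixes A B C :: "'a::semiring_0 mat"
  assumes "dim_row A = dim_row B" "dim_col A = dim_col B" "dim_col B = dim_row C"
  shows "(A + B) * C = A * C + B * C"
  by (rule add_mult_distrib_mat[of A "dim_row A" "dim_row C" B C "dim_col C"])
    (use assms in auto)

lemma mat_mult_add_dim:
  fixes A B C :: "'a::semiring_0 mat"
  assumes "dim_row B = dim_row C" "dim_col B = dim_col C" "dim_col A = dim_row B"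
  shows "A * (B + C) = A * B + A * C"
  by (rule mult_add_distrib_mat[of A "dim_row A" "dim_row C" B "dim_col C" C])
    (use assms in auto)

lemma mat_minus_mult_dim:
  fixes A B C :: "'a::ring mat"
  assumes "dim_row A = dim_row B" "dim_col A = dim_col B" "dim_col B = dim_row C"
  shows "(A - B) * C = A * C - B * C"
  by (rule minus_mult_distrib_mat[of A "dim_row A" "dim_row C" B C "dim_col C"])
    (use assms in auto)

lemma mat_mult_minus_dim:
  fixes A B C :: "'a::ring mat"
  assumes "dim_row B = dim_row C" "dim_col B = dim_col C" "dim_col A = dim_row B"
  shows "A * (B - C) = A * B - A * C"
  by (rule mult_minus_distrib_mat[of A "dim_row A" "dim_row C" B "dim_col C" C])
    (use assms in auto)

lemma mat_transpose_mult_dim: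
  fixes A B :: "'a::comm_semiring_0 mat"
  assumes "dim_col A = dim_row B"
  shows "transpose_mat (A * B) = transpose_mat B * transpose_mat A"
  by (rule transpose_mult[of A "dim_row A" "dim_row B" B "dim_col B"])
    (use assms in auto)

lemma mat_zero_mult_dim:
  fixes A :: "'a::semiring_0 mat"
  assumes "dim_row A = k"
  shows "0\<^sub>m l k * A = 0\<^sub>m l (dim_col A)"
  by (rule left_mult_zero_mat) (use assms in auto)

lemma mat_mult_zero_dim:
  fixes A :: "'a::semiring_0 mat"
  assumes "dim_col A = k"
  shows "A * 0\<^sub>m k l = 0\<^sub>m (dim_row A) l"
  by (rule right_mult_zero_mat) (use assms in auto)

lemma mat_one_mult_dim:
  fixes A :: "'a::semiring_1 mat"
  assumes "dim_row A = k"
  shows "1\<^sub>m k * A = A"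
  by (rule left_mult_one_mat) (use assms in auto)

lemma mat_mult_one_dim:
  fixes A :: "'a::semiring_1 mat"
  assumes "dim_col A = k"
  shows "A * 1\<^sub>m k = A"
  by (rule right_mult_one_mat) (use assms in auto)

lemma mat_uminus_mult_dim:
  fixes A B :: "'a::ring mat"
  assumes "dim_col A = dim_row B"
  shows "- A * B = - (A * B)" "A * - B = - (A * B)"
  using assms by auto

lemma mat_transpose_add_dim:
  fixes A B :: "'a::monoid_add mat"
  assumes "dim_row A = dim_row B" "dim_col A = dim_col B"
  shows "transpose_mat (A + B) = transpose_mat A + transpose_mat B"
  using assms by (intro eq_matI) auto

text \<open>Premises that equate \<open>dim_row\<close> and \<open>dim_col\<close> of the factors
  contain no free dimension variable, so these laws work as conditional rewrite rules; together they
  expand products into sums of right-nested products.\<close>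

lemmas mat_dim_simps = mat_assoc_dim mat_add_mult_dim mat_mult_add_dim mat_minus_mult_dim
  mat_mult_minus_dim mat_transpose_mult_dim mat_zero_mult_dim mat_mult_zero_dim
  mat_one_mult_dim mat_mult_one_dim mat_uminus_mult_dim mat_transpose_add_dim

section \<open>Orthogonal matrices and the existence of a lexicographic optimum\<close>

definition real_orthogonal :: "nat \<Rightarrow> real mat \<Rightarrow> bool" where
  "real_orthogonal k U \<longleftrightarrow> U \<in> carrier_mat k k \<and>
     transpose_mat U * U = 1\<^sub>m k \<and> U * transpose_mat U = 1\<^sub>m k"

lemma real_orthogonalI:
  assumes "U \<in> carrier_mat k k" "transpose_mat U * U = 1\<^sub>m k"
  shows "real_orthogonal k U"
  using assms mat_mult_left_right_inverse[of "transpose_mat U" k U]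
  by (auto simp: real_orthogonal_def)

lemma real_orthogonal_one: "real_orthogonal k (1\<^sub>m k)"
  by (simp add: real_orthogonal_def)

lemma real_orthogonal_transpose: "real_orthogonal k U \<Longrightarrow> real_orthogonal k (transpose_mat U)"
  by (auto simp: real_orthogonal_def)

lemma real_orthogonal_mult:
  assumes "real_orthogonal k U" "real_orthogonal k V"
  shows "real_orthogonal k (U * V)"
proof (rule real_orthogonalI)
  have c: "U \<in> carrier_mat k k" "V \<in> carrier_mat k k"
    using assms by (auto simp: real_orthogonal_def)
  then show "U * V \<in> carrier_mat k k" by simp
  have "transpose_mat (U * V) * (U * V) = transpose_mat V * ((transpose_mat U * U) * V)"
    using c by (simp add: mat_dim_simps)
  also have "\<dots> = 1\<^sub>m k"
    using assms by (auto simp: real_orthogonal_def)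
  finally show "transpose_mat (U * V) * (U * V) = 1\<^sub>m k" .
qed

text \<open>The weights are \<open>p\<close>, \<open>p - 1\<close>, down to \<open>1\<close>. Their
  positivity lets sign changes detect negative diagonal entries; their strict decrease lets
  rotations detect a wrong order and nonzero off-diagonal pairs.\<close>

definition weighted_trace :: "nat \<Rightarrow> real mat \<Rightarrow> real" where
  "weighted_trace p Z = (\<Sum>i<p. real (p - i) * Z $$ (i, i))"

text \<open>The maximisers of \<open>f\<close> form a closed, hence compact, subset on which
  \<open>g\<close> attains its own maximum.\<close>

lemma compact_attains_lex_sup:
  fixes f g :: "'a::topological_space \<Rightarrow> real"
  assumes "compact S" "S \<noteq> {}" "continuous_on S f" "continuous_on S g"
  shows "\<exists>x\<in>S. \<forall>y\<in>S. f y \<le> f x \<and> (f y = f x \<longrightarrow> g y \<le> g x)"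
proof -
  obtain x0 where x0: "x0 \<in> S" "\<forall>y\<in>S. f y \<le> f x0"
    using continuous_attains_sup[OF assms(1-3)] by blast
  define T where "T = S \<inter> f -` {f x0}"
  have "closedin (top_of_set S) T"
    unfolding T_def by (rule continuous_closedin_preimage) (use assms in auto)
  then have "compact T"
    using assms(1) closedin_compact by blast
  moreover have "T \<noteq> {}" "continuous_on T g"
    using x0 assms(4) by (auto simp: T_def intro: continuous_on_subset)
  ultimately obtain x where "x \<in> T" "\<forall>y\<in>T. g y \<le> g x"
    using continuous_attains_sup by blast
  then show ?thesis
    using x0 by (intro bexI[of _ x]) (auto simp: T_def)
qed

text \<open>The type of matrices carries no topology, so the orthogonal group is represented by entry
  functions, which live in a product space.\<close>

definition orthogonal_entries :: "nat \<Rightarrow> (nat \<times> nat \<Rightarrow> real) set" where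
  "orthogonal_entries m = {f. (\<forall>x. x \<notin> {..<m} \<times> {..<m} \<longrightarrow> f x = 0) \<and>
     (\<forall>i<m. \<forall>j<m. (\<Sum>k<m. f (k, i) * f (k, j)) = (if i = j then 1 else 0))}"

text \<open>Orthonormal columns have entries of absolute value at most one, so the set is cut out by
  closed conditions from a cube that is compact by Tychonoff.\<close>

lemma compact_orthogonal_entries: "compact (orthogonal_entries m)"
proof -
  let ?B = "PiE UNIV (\<lambda>_. {-1..1}) :: (nat \<times> nat \<Rightarrow> real) set"
  let ?Z = "(\<Inter>x\<in>- ({..<m} \<times> {..<m}). {f :: nat \<times> nat \<Rightarrow> real. f x = 0})"
  let ?O = "(\<Inter>i\<in>{..<m}. \<Inter>j\<in>{..<m}. {f :: nat \<times> nat \<Rightarrow> real.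
    (\<Sum>k<m. f (k, i) * f (k, j)) = (if i = j then 1 else 0)})"
  have "compactin (product_topology (\<lambda>_. euclidean) UNIV) ?B"
    by (subst compactin_PiE) auto
  then have B: "compact ?B"
    by (simp add: euclidean_product_topology)
  have Z: "closed ?Z"
    by (intro closed_INT ballI closed_Collect_eq continuous_intros) simp
  have O: "closed ?O"
    by (intro closed_INT ballI closed_Collect_eq continuous_intros) simp_all
  have bound: "\<bar>f (k, i)\<bar> \<le> 1" if f: "f \<in> orthogonal_entries m" for f k i
  proof (cases "k < m \<and> i < m")
    case True
    then have "f (k, i) * f (k, i) \<le> (\<Sum>k<m. f (k, i) * f (k, i))"
      by (intro member_le_sum) auto
    also have "\<dots> = 1"
      using f True by (simp add: orthogonal_entries_def)
    finally show ?thesis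
      by (simp add: abs_square_le_1 power2_eq_square[symmetric])
  next
    case False
    then have "f (k, i) = 0" using f by (auto simp: orthogonal_entries_def)
    then show ?thesis by simp
  qed
  have "orthogonal_entries m = ?B \<inter> (?Z \<inter> ?O)"
  proof (intro Set.set_eqI iffI)
    fix f assume f: "f \<in> orthogonal_entries m"
    then have "f \<in> ?Z \<inter> ?O"
      by (auto simp: orthogonal_entries_def)
    moreover have "f \<in> ?B"
      using bound[OF f] by (auto simp: abs_le_iff)
    ultimately show "f \<in> ?B \<inter> (?Z \<inter> ?O)" by simp
  next
    fix f assume "f \<in> ?B \<inter> (?Z \<inter> ?O)"
    then show "f \<in> orthogonal_entries m"
      by (auto simp: orthogonal_entries_def)
  qed
  then show ?thesis
    using B Z O by (simp add: compact_Int_closed closed_Int)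
qed

text \<open>Written out, the objective is a polynomial in finitely many coordinates, which makes it
  continuous for the product topology.\<close>

lemma weighted_trace_entries:
  fixes f g :: "nat \<times> nat \<Rightarrow> real"
  assumes "B \<in> carrier_mat m n"
  shows "weighted_trace (min m n) (transpose_mat (mat m m f) * B * mat n n g) =
    (\<Sum>i<min m n. real (min m n - i) * (\<Sum>l<n. (\<Sum>k<m. f (k, i) * B $$ (k, l)) * g (l, i)))"
  unfolding weighted_trace_def
  by (intro sum.cong refl)
    (use assms in \<open>auto simp: scalar_prod_def lessThan_atLeast0\<close>)

lemma exists_lex_optimal_orthogonal:
  assumes Bs: "Bs \<in> carrier_mat m n" and Bd: "Bd \<in> carrier_mat m n"
  defines "w \<equiv> weighted_trace (min m n)"
  shows "\<exists>U V. real_orthogonal m U \<and> real_orthogonal n V \<and>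
    (\<forall>U' V'. real_orthogonal m U' \<longrightarrow> real_orthogonal n V' \<longrightarrow>
      w (transpose_mat U' * Bs * V') \<le> w (transpose_mat U * Bs * V) \<and>
      (w (transpose_mat U' * Bs * V') = w (transpose_mat U * Bs * V) \<longrightarrow>
       w (transpose_mat U' * Bd * V') \<le> w (transpose_mat U * Bd * V)))"
proof -
  define S where "S = orthogonal_entries m \<times> orthogonal_entries n"
  define F where "F B x = w (transpose_mat (mat m m (fst x)) * B * mat n n (snd x))"
    for B and x :: "(nat \<times> nat \<Rightarrow> real) \<times> (nat \<times> nat \<Rightarrow> real)"
  \<comment> \<open>The identity matrix shows that \<open>S\<close> is nonempty; the guard
    \<open>i < k\<close> makes its entry function vanish outside the index square.\<close>
  have id: "(\<lambda>(i, j). if i = j \<and> i < k then 1 else 0) \<in> orthogonal_entries k" for k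
  proof -
    have "(\<Sum>q<k. (if q = i \<and> q < k then 1 else 0) * (if q = j \<and> q < k then 1 else 0))
        = (if i = j then 1 else (0::real))" if "i < k" for i j
    proof -
      have "(\<Sum>q<k. (if q = i \<and> q < k then 1 else 0) * (if q = j \<and> q < k then 1 else 0))
        = (\<Sum>q<k. if q = i then (if i = j then 1 else (0::real)) else 0)"
        by (intro sum.cong) auto
      then show ?thesis using that by simp
    qed
    then show ?thesis by (auto simp: orthogonal_entries_def)
  qed
  have comp: "compact S" "S \<noteq> {}"
    using id by (auto simp: S_def intro: compact_Times compact_orthogonal_entries)
  have cont: "continuous_on S (F B)" if "B \<in> carrier_mat m n" for B
    unfolding F_def w_def weighted_trace_entries[OF that]
    by (intro continuous_intros continuous_on_product_then_coordinatewise[OF continuous_on_fst]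
       continuous_on_product_then_coordinatewise[OF continuous_on_snd])
  obtain x where x: "x \<in> S" "\<forall>y\<in>S. F Bs y \<le> F Bs x \<and> (F Bs y = F Bs x \<longrightarrow> F Bd y \<le> F Bd x)"
    using compact_attains_lex_sup[OF comp cont[OF Bs] cont[OF Bd]] by blast
  have toO: "real_orthogonal k (mat k k f)" if "f \<in> orthogonal_entries k" for f k
    by (rule real_orthogonalI)
      (use that in \<open>auto intro!: eq_matI simp: orthogonal_entries_def scalar_prod_def lessThan_atLeast0\<close>)
  have fromO: "\<exists>f\<in>orthogonal_entries k. U = mat k k f" if U: "real_orthogonal k U" for U k
  proof -
    define f where "f = (\<lambda>x. if x \<in> {..<k} \<times> {..<k} then U $$ x else 0)"
    have "U = mat k k f"
      using U by (auto simp: f_def real_orthogonal_def intro!: eq_matI)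
    moreover have "(\<Sum>q<k. f (q, i) * f (q, j)) = (if i = j then 1 else 0)" if "i < k" "j < k" for i j
    proof -
      have "(\<Sum>q<k. f (q, i) * f (q, j)) = (transpose_mat U * U) $$ (i, j)"
        using that carrier_matD[OF conjunct1[OF U[unfolded real_orthogonal_def]]]
        by (simp add: f_def scalar_prod_def lessThan_atLeast0)
      then show ?thesis using U that by (simp add: real_orthogonal_def)
    qed
    ultimately show ?thesis
      by (intro bexI[of _ f]) (auto simp: orthogonal_entries_def f_def)
  qed
  show ?thesis
  proof (intro exI conjI allI impI)
    show "real_orthogonal m (mat m m (fst x))" "real_orthogonal n (mat n n (snd x))"
      using x(1) toO by (auto simp: S_def)
  next
    fix U' V' assume U': "real_orthogonal m U'" and V': "real_orthogonal n V'"
    obtain f g where fg: "f \<in> orthogonal_entries m" "U' = mat m m f" "g \<in> orthogonal_entries n" "V' = mat n n g"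
      using fromO[OF U'] fromO[OF V'] by blast
    then have "(f, g) \<in> S" by (simp add: S_def)
    note y = x(2)[rule_format, OF this]
    show "w (transpose_mat U' * Bs * V') \<le> w (transpose_mat (mat m m (fst x)) * Bs * mat n n (snd x))"
      using y by (simp add: F_def fg)
    show "w (transpose_mat U' * Bd * V') \<le> w (transpose_mat (mat m m (fst x)) * Bd * mat n n (snd x))"
      if "w (transpose_mat U' * Bs * V') = w (transpose_mat (mat m m (fst x)) * Bs * mat n n (snd x))"
      using y that by (simp add: F_def fg)
  qed
qed

section \<open>Plane rotations and sign changes as competitors\<close>

lemma sum_two_point:
  fixes z :: "nat \<Rightarrow> real"
  assumes "i \<noteq> j"
  shows "(\<Sum>q<p. (if q = i then a else if q = j then b else 0) * z q)
    = (if i < p then a * z i else 0) + (if j < p then b * z j else 0)"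
proof -
  have "(\<Sum>q<p. (if q = i then a else if q = j then b else 0) * z q)
    = (\<Sum>q<p. (if q = i then a * z i else 0) + (if q = j then b * z j else 0))"
    using assms by (intro sum.cong) auto
  then show ?thesis
    by (simp add: sum.distrib)
qed

definition plane_rotation :: "nat \<Rightarrow> nat \<Rightarrow> nat \<Rightarrow> real \<Rightarrow> real \<Rightarrow> real mat" where
  "plane_rotation m i j c s = mat m m (\<lambda>(k, l).
     if k = i then (if l = i then c else if l = j then s else 0)
     else if k = j then (if l = i then - s else if l = j then c else 0)
     else if l = k then 1 else 0)"

lemma plane_rotation_mult:
  assumes "Z \<in> carrier_mat m n" "i < m" "j < m" "i \<noteq> j"
  shows "plane_rotation m i j c s * Z = mat m n (\<lambda>(k, l).
    if k = i then c * Z $$ (i, l) + s * Z $$ (j, l)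
    else if k = j then - s * Z $$ (i, l) + c * Z $$ (j, l) else Z $$ (k, l))"
proof (rule eq_matI)
  fix k l
  assume kl: "k < dim_row (mat m n (\<lambda>(k, l).
    if k = i then c * Z $$ (i, l) + s * Z $$ (j, l)
    else if k = j then - s * Z $$ (i, l) + c * Z $$ (j, l) else Z $$ (k, l)))"
   "l < dim_col (mat m n (\<lambda>(k, l).
    if k = i then c * Z $$ (i, l) + s * Z $$ (j, l)
    else if k = j then - s * Z $$ (i, l) + c * Z $$ (j, l) else Z $$ (k, l)))"
  have "(plane_rotation m i j c s * Z) $$ (k, l) = (\<Sum>q<m. plane_rotation m i j c s $$ (k, q) * Z $$ (q, l))"
    using kl assms by (simp add: plane_rotation_def scalar_prod_def lessThan_atLeast0)
  also have "\<dots> = (\<Sum>q<m. (if k = i then (if q = i then c else if q = j then s else 0)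
     else if k = j then (if q = i then - s else if q = j then c else 0)
     else if q = k then 1 else 0) * Z $$ (q, l))"
    using kl by (intro sum.cong) (auto simp: plane_rotation_def)
  also have "\<dots> = (if k = i then c * Z $$ (i, l) + s * Z $$ (j, l)
    else if k = j then - s * Z $$ (i, l) + c * Z $$ (j, l) else Z $$ (k, l))"
  proof -
    consider "k = i" | "k = j" "k \<noteq> i" | "k \<noteq> i" "k \<noteq> j" by blast
    then show ?thesis
    proof cases
      case 1 then show ?thesis using assms kl by (simp add: sum_two_point)
    next
      case 2 then show ?thesis using assms kl by (simp add: sum_two_point)
    next
      case 3
      have "(\<Sum>q<m. (if q = k then 1 else 0) * Z $$ (q, l)) = (\<Sum>q<m. if q = k then Z $$ (k, l) else 0)"
        by (intro sum.cong) auto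
      then show ?thesis using 3 kl by simp
    qed
  qed
  finally show "(plane_rotation m i j c s * Z) $$ (k, l) = mat m n (\<lambda>(k, l).
    if k = i then c * Z $$ (i, l) + s * Z $$ (j, l)
    else if k = j then - s * Z $$ (i, l) + c * Z $$ (j, l) else Z $$ (k, l)) $$ (k, l)"
    using kl by simp
qed (use assms in \<open>auto simp: plane_rotation_def\<close>)

lemma plane_rotation_orthogonal:
  assumes "c\<^sup>2 + s\<^sup>2 = 1" "i < m" "j < m" "i \<noteq> j"
  shows "real_orthogonal m (plane_rotation m i j c s)"
proof (rule real_orthogonalI)
  have t: "transpose_mat (plane_rotation m i j c s) = plane_rotation m i j c (- s)"
    using assms by (intro eq_matI) (auto simp: plane_rotation_def)
  show c: "plane_rotation m i j c s \<in> carrier_mat m m"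
    by (simp add: plane_rotation_def)
  have cs: "c * c + s * s = 1" "s * s + c * c = 1" using assms(1) by (auto simp: power2_eq_square)
  show "transpose_mat (plane_rotation m i j c s) * plane_rotation m i j c s = 1\<^sub>m m"
    unfolding t plane_rotation_mult[OF c assms(2-)]
    using assms cs by (intro eq_matI) (auto simp: plane_rotation_def)
qed

text \<open>Only two diagonal positions change. The index \<open>j\<close> may be a surplus row
  beyond the diagonal: then \<open>p - j\<close> is zero in natural subtraction, and the last term
  disappears.\<close>

lemma weighted_trace_plane_rotation:
  assumes Z: "Z \<in> carrier_mat m n" and ij: "i < min m n" "j < m" "i \<noteq> j"
  defines "p \<equiv> min m n"
  shows "weighted_trace p (plane_rotation m i j c s * Z) = weighted_trace p Z
    + real (p - i) * ((c - 1) * Z $$ (i, i) + s * Z $$ (j, i))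
    + real (p - j) * ((c - 1) * Z $$ (j, j) - s * Z $$ (i, j))"
proof -
  have "weighted_trace p (plane_rotation m i j c s * Z) - weighted_trace p Z
    = (\<Sum>k<p. (if k = i then (c - 1) * Z $$ (i, i) + s * Z $$ (j, i)
        else if k = j then (c - 1) * Z $$ (j, j) - s * Z $$ (i, j) else 0) * real (p - k))"
    unfolding weighted_trace_def sum_subtractf[symmetric]
    unfolding plane_rotation_mult[OF Z less_le_trans[OF ij(1) min.cobounded1] ij(2,3)]
    by (intro sum.cong refl) (auto simp: p_def algebra_simps)
  also have "\<dots> = ((c - 1) * Z $$ (i, i) + s * Z $$ (j, i)) * real (p - i)
      + ((c - 1) * Z $$ (j, j) - s * Z $$ (i, j)) * real (p - j)"
    using assms by (subst sum_two_point) auto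
  finally show ?thesis
    by (simp only: algebra_simps)
qed

text \<open>Rotating rows and columns alike preserves the trace of the two-by-two block, so position
  \<open>i\<close> gains what position \<open>j\<close> loses and only the difference of the weights
  counts.\<close>

lemma weighted_trace_two_sided_plane_rotation:
  assumes Z: "Z \<in> carrier_mat m n" and ij: "i < min m n" "j < min m n" "i \<noteq> j"
    and cs: "c\<^sup>2 + s\<^sup>2 = 1"
  defines "p \<equiv> min m n"
  shows "weighted_trace p (plane_rotation m i j c s * Z * transpose_mat (plane_rotation n i j c s))
    = weighted_trace p Z
    + (real (p - i) - real (p - j)) *
       (s\<^sup>2 * (Z $$ (j, j) - Z $$ (i, i)) + c * s * (Z $$ (i, j) + Z $$ (j, i)))"
proof -
  let ?R = "plane_rotation m i j c s" and ?T = "plane_rotation n i j c s"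
  have cR: "?R \<in> carrier_mat m m" "?T \<in> carrier_mat n n" by (auto simp: plane_rotation_def)
  \<comment> \<open>Transposition turns the rotation of columns into a second rotation of
    rows.\<close>
  have eq: "?R * Z * transpose_mat ?T = transpose_mat (?T * transpose_mat (?R * Z))"
    using Z cR by (simp add: mat_dim_simps)
  have RZ: "transpose_mat (?R * Z) \<in> carrier_mat n m" using Z cR by simp
  have ijn: "i < n" "j < n" "i < m" "j < m" using ij by auto
  have ent: "(?R * Z * transpose_mat ?T) $$ (k, k) =
     (if k = i then c * (c * Z $$ (i, i) + s * Z $$ (j, i)) + s * (c * Z $$ (i, j) + s * Z $$ (j, j))
      else if k = j then - s * (- s * Z $$ (i, i) + c * Z $$ (j, i)) + c * (- s * Z $$ (i, j) + c * Z $$ (j, j))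
      else Z $$ (k, k))" if "k < p" for k
    unfolding eq plane_rotation_mult[OF RZ ijn(1,2) ij(3)]
    unfolding plane_rotation_mult[OF Z ijn(3,4) ij(3)]
    using that ij by (auto simp: p_def)
  have c2: "c * c = 1 - s * s" using cs by (simp add: power2_eq_square)
  let ?D = "s\<^sup>2 * (Z $$ (j, j) - Z $$ (i, i)) + c * s * (Z $$ (i, j) + Z $$ (j, i))"
  have i1: "c * (c * a + s * b) + s * (c * d + s * e) = a + (s\<^sup>2 * (e - a) + c * s * (d + b))" for a b d e
  proof -
    have "c * (c * a + s * b) + s * (c * d + s * e) = (c * c) * a + c * s * b + s * c * d + s * s * e"
      by (simp add: algebra_simps)
    then show ?thesis unfolding c2 by (simp add: algebra_simps power2_eq_square)
  qed
  have i2: "- s * (- s * a + c * b) + c * (- s * d + c * e) = e - (s\<^sup>2 * (e - a) + c * s * (d + b))" for a b d e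
  proof -
    have "- s * (- s * a + c * b) + c * (- s * d + c * e) = s * s * a - c * s * b - s * c * d + (c * c) * e"
      by (simp add: algebra_simps)
    then show ?thesis unfolding c2 by (simp add: algebra_simps power2_eq_square)
  qed
  have "weighted_trace p (?R * Z * transpose_mat ?T) - weighted_trace p Z
    = (\<Sum>k<p. (if k = i then ?D else if k = j then - ?D else 0) * real (p - k))"
    unfolding weighted_trace_def sum_subtractf[symmetric]
    by (intro sum.cong refl) (simp only: ent lessThan_iff i1 i2, auto simp: algebra_simps)
  also have "\<dots> = (real (p - i) - real (p - j)) * ?D"
    using ij by (subst sum_two_point) (auto simp: p_def algebra_simps)
  finally show ?thesis by simp
qed

definition coordinate_flip :: "nat \<Rightarrow> nat \<Rightarrow> real mat" where
  "coordinate_flip m i = mat m m (\<lambda>(k, l). if l = k then (if k = i then -1 else 1) else 0)"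

lemma coordinate_flip_mult:
  assumes "Z \<in> carrier_mat m n"
  shows "coordinate_flip m i * Z = mat m n (\<lambda>(k, l). if k = i then - Z $$ (k, l) else Z $$ (k, l))"
proof (rule eq_matI)
  fix k l
  assume kl: "k < dim_row (mat m n (\<lambda>(k, l). if k = i then - Z $$ (k, l) else Z $$ (k, l)))"
    "l < dim_col (mat m n (\<lambda>(k, l). if k = i then - Z $$ (k, l) else Z $$ (k, l)))"
  have "(coordinate_flip m i * Z) $$ (k, l) = (\<Sum>q<m. coordinate_flip m i $$ (k, q) * Z $$ (q, l))"
    using kl assms by (simp add: coordinate_flip_def scalar_prod_def lessThan_atLeast0)
  also have "\<dots> = (\<Sum>q<m. if q = k then (if k = i then - Z $$ (k, l) else Z $$ (k, l)) else 0)"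
    using kl by (intro sum.cong) (auto simp: coordinate_flip_def)
  finally show "(coordinate_flip m i * Z) $$ (k, l) =
      mat m n (\<lambda>(k, l). if k = i then - Z $$ (k, l) else Z $$ (k, l)) $$ (k, l)"
    using kl by simp
qed (use assms in \<open>auto simp: coordinate_flip_def\<close>)

lemma coordinate_flip_orthogonal: "real_orthogonal m (coordinate_flip m i)"
proof (rule real_orthogonalI)
  have t: "transpose_mat (coordinate_flip m i) = coordinate_flip m i"
    by (intro eq_matI) (auto simp: coordinate_flip_def)
  show c: "coordinate_flip m i \<in> carrier_mat m m"
    by (simp add: coordinate_flip_def)
  show "transpose_mat (coordinate_flip m i) * coordinate_flip m i = 1\<^sub>m m"
    unfolding t coordinate_flip_mult[OF c] by (intro eq_matI) (auto simp: coordinate_flip_def)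
qed

lemma weighted_trace_coordinate_flip:
  assumes "Z \<in> carrier_mat m n" "i < min m n"
  shows "weighted_trace (min m n) (coordinate_flip m i * Z)
    = weighted_trace (min m n) Z - 2 * real (min m n - i) * Z $$ (i, i)"
proof -
  have "weighted_trace (min m n) (coordinate_flip m i * Z) - weighted_trace (min m n) Z
    = (\<Sum>k<min m n. if k = i then - 2 * real (min m n - i) * Z $$ (i, i) else 0)"
    unfolding weighted_trace_def sum_subtractf[symmetric] coordinate_flip_mult[OF assms(1)]
    by (intro sum.cong refl) (auto simp: algebra_simps)
  also have "\<dots> = - 2 * real (min m n - i) * Z $$ (i, i)" using assms by simp
  finally show ?thesis by linarith
qed

section \<open>Extremal conditions on the unit circle and optimal pairs\<close>

lemma circle_linear_max:
  fixes a b :: real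
  assumes "\<And>c s. c\<^sup>2 + s\<^sup>2 = 1 \<Longrightarrow> a * (c - 1) + b * s \<le> 0"
  shows "b = 0"
proof (rule ccontr)
  assume b: "b \<noteq> 0"
  \<comment> \<open>On the circle \<open>a * c + b * s\<close> reaches its maximum \<open>h\<close>
    at \<open>(a / h, b / h)\<close>. The hypothesis bounds it by the value \<open>a\<close> at
    \<open>(1, 0)\<close>, so \<open>h \<le> a\<close>, which leaves no room for
    \<open>b\<close>.\<close>
  define h where "h = sqrt (a\<^sup>2 + b\<^sup>2)"
  have h2: "h\<^sup>2 = a\<^sup>2 + b\<^sup>2" by (simp add: h_def)
  have h: "h > 0" using b by (simp add: h_def sum_power2_gt_zero_iff)
  have "(a / h)\<^sup>2 + (b / h)\<^sup>2 = 1"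
    using h by (simp add: power_divide add_divide_distrib[symmetric] h2[symmetric])
  from assms[OF this] have "a * a / h + b * b / h \<le> a"
    by (simp add: algebra_simps)
  moreover have "a * a / h + b * b / h = h"
    using h by (simp add: add_divide_distrib[symmetric] h2[unfolded power2_eq_square, symmetric])
  ultimately have "h \<le> a" by simp
  then have "h\<^sup>2 \<le> a\<^sup>2" using h by (intro power_mono) auto
  then show False using b h2 by simp
qed

lemma circle_quadratic_max:
  fixes a b :: real
  assumes "\<And>c s. c\<^sup>2 + s\<^sup>2 = 1 \<Longrightarrow> s\<^sup>2 * a + c * s * b \<le> 0"
  shows "a \<le> 0" "b = 0"
proof -
  show "a \<le> 0" using assms[of 0 1] by simp
  show "b = 0"
  proof (rule ccontr)
    assume b: "b \<noteq> 0"
    \<comment> \<open>The slope \<open>s / c\<close> is chosen so that the cross term beats the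
      quadratic one: \<open>t * b\<close> equals \<open>t\<^sup>2 * (\<bar>a\<bar> + 1)\<close>, and
      the sum becomes positive.\<close>
    define t where "t = b / (\<bar>a\<bar> + 1)"
    define h where "h = sqrt (1 + t\<^sup>2)"
    have h: "h > 0" by (simp add: h_def add_pos_nonneg)
    have h2: "h\<^sup>2 = 1 + t\<^sup>2" by (simp add: h_def)
    have "(1 / h)\<^sup>2 + (t / h)\<^sup>2 = 1"
      using h by (simp add: power_divide add_divide_distrib[symmetric] h2[symmetric])
    from assms[OF this] have "(t\<^sup>2 * a + t * b) / h\<^sup>2 \<le> 0"
      by (simp add: power_divide add_divide_distrib power2_eq_square)
    then have "t\<^sup>2 * a + t * b \<le> 0"
      using h by (simp add: divide_le_0_iff not_le[symmetric])
    moreover have "b = t * (\<bar>a\<bar> + 1)" by (simp add: t_def)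
    then have "t\<^sup>2 * a + t * b = t\<^sup>2 * (a + \<bar>a\<bar> + 1)"
      by (simp add: power2_eq_square algebra_simps)
    moreover have "t \<noteq> 0" using b by (simp add: t_def)
    moreover have "a + \<bar>a\<bar> + 1 > 0" by linarith
    ultimately show False by (metis mult_pos_pos not_less zero_less_power2)
  qed
qed

text \<open>The optimal pair is absorbed into \<open>C\<close> and \<open>M\<close>: the identity
  matrices become the maximisers, and \<open>R\<close> and \<open>T\<close> range over all
  competitors.\<close>

definition lex_optimal :: "nat \<Rightarrow> nat \<Rightarrow> real mat \<Rightarrow> real mat \<Rightarrow> bool" where
  "lex_optimal m n C M \<longleftrightarrow> C \<in> carrier_mat m n \<and> M \<in> carrier_mat m n \<and>
    (\<forall>R T. real_orthogonal m R \<longrightarrow> real_orthogonal n T \<longrightarrow>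
      weighted_trace (min m n) (R * C * T) \<le> weighted_trace (min m n) C \<and>
      (weighted_trace (min m n) (R * C * T) = weighted_trace (min m n) C \<longrightarrow>
       weighted_trace (min m n) (R * M * T) \<le> weighted_trace (min m n) M))"

text \<open>Orthogonal matrices form a group, so multiplying by \<open>R\<close> and
  \<open>T\<close> amounts to moving from \<open>(U, V)\<close> to another orthogonal pair.\<close>

lemma exists_lex_optimal:
  assumes Bs: "Bs \<in> carrier_mat m n" and Bd: "Bd \<in> carrier_mat m n"
  shows "\<exists>U V. real_orthogonal m U \<and> real_orthogonal n V \<and>
    lex_optimal m n (transpose_mat U * Bs * V) (transpose_mat U * Bd * V)"
proof -
  obtain U V where UV: "real_orthogonal m U" "real_orthogonal n V"
    and opt: "\<And>U' V'. real_orthogonal m U' \<Longrightarrow> real_orthogonal n V' \<Longrightarrow>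
      weighted_trace (min m n) (transpose_mat U' * Bs * V') \<le> weighted_trace (min m n) (transpose_mat U * Bs * V) \<and>
      (weighted_trace (min m n) (transpose_mat U' * Bs * V') = weighted_trace (min m n) (transpose_mat U * Bs * V) \<longrightarrow>
       weighted_trace (min m n) (transpose_mat U' * Bd * V') \<le> weighted_trace (min m n) (transpose_mat U * Bd * V))"
    using exists_lex_optimal_orthogonal[OF Bs Bd] by blast
  have cU: "U \<in> carrier_mat m m" "V \<in> carrier_mat n n"
    using UV by (auto simp: real_orthogonal_def)
  have main: "weighted_trace (min m n) (R * (transpose_mat U * Bs * V) * T) \<le> weighted_trace (min m n) (transpose_mat U * Bs * V) \<and>
      (weighted_trace (min m n) (R * (transpose_mat U * Bs * V) * T) = weighted_trace (min m n) (transpose_mat U * Bs * V) \<longrightarrow>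
       weighted_trace (min m n) (R * (transpose_mat U * Bd * V) * T) \<le> weighted_trace (min m n) (transpose_mat U * Bd * V))"
    if R: "real_orthogonal m R" and T: "real_orthogonal n T" for R T
  proof -
    have cR: "R \<in> carrier_mat m m" "T \<in> carrier_mat n n"
      using R T by (auto simp: real_orthogonal_def)
    have "transpose_mat (U * transpose_mat R) * B * (V * T) = R * (transpose_mat U * B * V) * T"
      if "B \<in> carrier_mat m n" for B
      using that cR cU by (simp add: mat_dim_simps)
    then show ?thesis
      using opt[OF real_orthogonal_mult[OF UV(1) real_orthogonal_transpose[OF R]]
          real_orthogonal_mult[OF UV(2) T]] Bs Bd by simp
  qed
  have c: "transpose_mat U * B * V \<in> carrier_mat m n" if "B \<in> carrier_mat m n" for B
    using that cU by auto
  have "lex_optimal m n (transpose_mat U * Bs * V) (transpose_mat U * Bd * V)"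
    unfolding lex_optimal_def by (intro conjI[OF c[OF Bs]] conjI[OF c[OF Bd]] allI impI main)
  then show ?thesis using UV by blast
qed

section \<open>Consequences of lexicographic optimality\<close>

lemma weighted_trace_transpose:
  assumes "Z \<in> carrier_mat m n"
  shows "weighted_trace (min n m) (transpose_mat Z) = weighted_trace (min m n) Z"
  unfolding weighted_trace_def using assms by (intro sum.cong) auto

text \<open>This duality turns every statement obtained from row rotations into one about column
  rotations.\<close>

lemma lex_optimal_transpose:
  assumes "lex_optimal m n C M"
  shows "lex_optimal n m (transpose_mat C) (transpose_mat M)"
proof -
  have CM: "C \<in> carrier_mat m n" "M \<in> carrier_mat m n"
    using assms by (auto simp: lex_optimal_def)
  have eq: "weighted_trace (min n m) (R * transpose_mat Z * T)
      = weighted_trace (min m n) (transpose_mat T * Z * transpose_mat R)"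
    if "real_orthogonal n R" "real_orthogonal m T" "Z \<in> carrier_mat m n" for R T Z
  proof -
    have c: "R \<in> carrier_mat n n" "T \<in> carrier_mat m m"
      using that by (auto simp: real_orthogonal_def)
    then have "R * transpose_mat Z * T = transpose_mat (transpose_mat T * Z * transpose_mat R)"
      using that(3) by (simp add: mat_dim_simps)
    moreover have "transpose_mat T * Z * transpose_mat R \<in> carrier_mat m n"
      using c that(3) by auto
    ultimately show ?thesis
      using weighted_trace_transpose by metis
  qed
  show ?thesis
    unfolding lex_optimal_def
  proof (intro conjI allI impI)
    fix R T assume RT: "real_orthogonal n R" "real_orthogonal m T"
    note o = assms[unfolded lex_optimal_def, THEN conjunct2, THEN conjunct2, rule_format,
        OF real_orthogonal_transpose[OF RT(2)] real_orthogonal_transpose[OF RT(1)]]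
    show "weighted_trace (min n m) (R * transpose_mat C * T) \<le> weighted_trace (min n m) (transpose_mat C)"
      using o CM by (simp add: eq[OF RT] weighted_trace_transpose)
    show "weighted_trace (min n m) (R * transpose_mat M * T) \<le> weighted_trace (min n m) (transpose_mat M)"
      if "weighted_trace (min n m) (R * transpose_mat C * T) = weighted_trace (min n m) (transpose_mat C)"
      using o that CM by (simp add: eq[OF RT] weighted_trace_transpose)
  qed (use CM in auto)
qed

lemma lex_optimal_left:
  assumes "lex_optimal m n C M" "real_orthogonal m R"
  shows "weighted_trace (min m n) (R * C) \<le> weighted_trace (min m n) C"
    "weighted_trace (min m n) (R * C) = weighted_trace (min m n) C \<Longrightarrow>
     weighted_trace (min m n) (R * M) \<le> weighted_trace (min m n) M"
proof -
  have "R * C \<in> carrier_mat m n" "R * M \<in> carrier_mat m n"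
    using assms by (auto simp: lex_optimal_def real_orthogonal_def)
  then have c: "R * C * 1\<^sub>m n = R * C" "R * M * 1\<^sub>m n = R * M"
    by (auto simp: mat_mult_one_dim)
  note o = assms(1)[unfolded lex_optimal_def, THEN conjunct2, THEN conjunct2, rule_format,
        OF assms(2) real_orthogonal_one, unfolded c]
  show "weighted_trace (min m n) (R * C) \<le> weighted_trace (min m n) C"
    "weighted_trace (min m n) (R * C) = weighted_trace (min m n) C \<Longrightarrow>
     weighted_trace (min m n) (R * M) \<le> weighted_trace (min m n) M"
    using o by blast+
qed

text \<open>At an optimum the first-order change under a rotation of rows \<open>i\<close> and
  \<open>j\<close> vanishes. If the entries of \<open>C\<close> involved are zero, all these
  rotations tie in the first objective, and the same argument applies to \<open>M\<close>.\<close>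

lemma lex_optimal_row:
  assumes opt: "lex_optimal m n C M" and ij: "i < min m n" "j < m" "i \<noteq> j"
  shows "real (min m n - i) * C $$ (j, i) = real (min m n - j) * C $$ (i, j)"
    and "C $$ (i, i) = 0 \<Longrightarrow> C $$ (j, i) = 0 \<Longrightarrow>
      (j < min m n \<Longrightarrow> C $$ (j, j) = 0 \<and> C $$ (i, j) = 0) \<Longrightarrow>
      real (min m n - i) * M $$ (j, i) = real (min m n - j) * M $$ (i, j)"
proof -
  define p where "p = min m n"
  have CM: "C \<in> carrier_mat m n" "M \<in> carrier_mat m n"
    using opt by (auto simp: lex_optimal_def)
  have im: "i < m" using ij by simp
  note wt = weighted_trace_plane_rotation[OF _ ij, folded p_def]
  note left = lex_optimal_left[OF opt plane_rotation_orthogonal[OF _ im ij(2,3)], folded p_def]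
  have "real (p - i) * C $$ (j, i) - real (p - j) * C $$ (i, j) = 0"
  proof (rule circle_linear_max)
    fix c s :: real assume "c\<^sup>2 + s\<^sup>2 = 1"
    from left(1)[OF this]
    show "(real (p - i) * C $$ (i, i) + real (p - j) * C $$ (j, j)) * (c - 1)
        + (real (p - i) * C $$ (j, i) - real (p - j) * C $$ (i, j)) * s \<le> 0"
      unfolding wt[OF CM(1)] by (simp only: algebra_simps)
  qed
  then show "real (min m n - i) * C $$ (j, i) = real (min m n - j) * C $$ (i, j)"
    by (simp add: p_def)
  assume z: "C $$ (i, i) = 0" "C $$ (j, i) = 0"
    "j < min m n \<Longrightarrow> C $$ (j, j) = 0 \<and> C $$ (i, j) = 0"
  have "real (p - i) * M $$ (j, i) - real (p - j) * M $$ (i, j) = 0"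
  proof (rule circle_linear_max)
    fix c s :: real assume cs: "c\<^sup>2 + s\<^sup>2 = 1"
    \<comment> \<open>For \<open>j \<ge> p\<close> the weight is zero, whatever the out-of-range
      entries denote.\<close>
    have "real (p - j) * ((c - 1) * C $$ (j, j) - s * C $$ (i, j)) = 0"
      using z(3) by (cases "j < p") (auto simp: p_def)
    then have "weighted_trace p (plane_rotation m i j c s * C) = weighted_trace p C"
      unfolding wt[OF CM(1)] using z(1,2) by simp
    from left(2)[OF cs this]
    show "(real (p - i) * M $$ (i, i) + real (p - j) * M $$ (j, j)) * (c - 1)
        + (real (p - i) * M $$ (j, i) - real (p - j) * M $$ (i, j)) * s \<le> 0"
      unfolding wt[OF CM(2)] by (simp only: algebra_simps)
  qed
  then show "real (min m n - i) * M $$ (j, i) = real (min m n - j) * M $$ (i, j)"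
    by (simp add: p_def)
qed

text \<open>Adding and subtracting the equations separates \<open>x + y\<close>, with factor
  \<open>v - w\<close>, from \<open>x - y\<close>, with factor \<open>v + w\<close>; neither factor
  is zero.\<close>

lemma weighted_symmetric_zero:
  fixes x y v w :: real
  assumes "v * x = w * y" "v * y = w * x" "v \<ge> 0" "w \<ge> 0" "v \<noteq> w"
  shows "x = 0" "y = 0"
proof -
  have "(v - w) * (x + y) = 0" "(v + w) * (x - y) = 0"
    using assms(1,2) by (simp_all add: algebra_simps)
  moreover have "v + w > 0" using assms(3-5) by linarith
  ultimately have "x + y = 0" "x - y = 0" using assms(5) by auto
  then show "x = 0" "y = 0" by linarith+
qed

text \<open>Row and column rotations give two equations for a symmetric pair of entries with
  distinct weights. Outside the leading square one weight is zero, and a single equation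
  suffices.\<close>

lemma lex_optimal_diagonal:
  assumes opt: "lex_optimal m n C M" and ij: "i < m" "j < n" "i \<noteq> j"
  shows "C $$ (i, j) = 0"
proof -
  have CM: "C \<in> carrier_mat m n" "M \<in> carrier_mat m n"
    using opt by (auto simp: lex_optimal_def)
  note optT = lex_optimal_transpose[OF opt]
  consider "i < min m n" "j < min m n" | "j < min m n" "i \<ge> min m n" | "i < min m n" "j \<ge> min m n"
    using ij by linarith
  then show ?thesis
  proof cases
    case 1
    have "real (min m n - i) * C $$ (j, i) = real (min m n - j) * C $$ (i, j)"
      using lex_optimal_row(1)[OF opt, of i j] 1 ij by simp
    moreover have "real (min m n - i) * C $$ (i, j) = real (min m n - j) * C $$ (j, i)"
      using lex_optimal_row(1)[OF optT, of i j] 1 ij CM by (simp add: min.commute)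
    ultimately show ?thesis
      by (rule weighted_symmetric_zero) (use 1 ij in auto)
  next
    case 2
    then have "real (min m n - j) * C $$ (i, j) = 0"
      using lex_optimal_row(1)[OF opt, of j i] ij by simp
    then show ?thesis using 2 by simp
  next
    case 3
    then have "real (min m n - i) * C $$ (i, j) = 0"
      using lex_optimal_row(1)[OF optT, of i j] ij CM by (simp add: min.commute)
    then show ?thesis using 3 by simp
  qed
qed

text \<open>Where the singular values vanish, rows and columns rotate independently without changing
  the first objective, so the argument for diagonality of \<open>C\<close> carries over to
  \<open>M\<close>.\<close>

lemma lex_optimal_null_block:
  assumes opt: "lex_optimal m n C M" and ij: "i < m" "j < n" "i \<noteq> j"
    and z: "i < min m n \<Longrightarrow> C $$ (i, i) = 0" "j < min m n \<Longrightarrow> C $$ (j, j) = 0"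
  shows "M $$ (i, j) = 0"
proof -
  have CM: "C \<in> carrier_mat m n" "M \<in> carrier_mat m n"
    using opt by (auto simp: lex_optimal_def)
  note optT = lex_optimal_transpose[OF opt]
  note diag = lex_optimal_diagonal[OF opt]
  consider "i < min m n" "j < min m n" | "j < min m n" "i \<ge> min m n" | "i < min m n" "j \<ge> min m n"
    using ij by linarith
  then show ?thesis
  proof cases
    case 1
    have "real (min m n - i) * M $$ (j, i) = real (min m n - j) * M $$ (i, j)"
      using 1 ij z diag by (intro lex_optimal_row(2)[OF opt]) auto
    moreover have "real (min n m - i) * transpose_mat M $$ (j, i) = real (min n m - j) * transpose_mat M $$ (i, j)"
      using 1 ij z diag CM by (intro lex_optimal_row(2)[OF optT]) auto
    then have "real (min m n - i) * M $$ (i, j) = real (min m n - j) * M $$ (j, i)"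
      using CM ij 1 by (simp add: min.commute)
    ultimately show ?thesis
      by (rule weighted_symmetric_zero) (use 1 ij in auto)
  next
    case 2
    have "real (min m n - j) * M $$ (i, j) = real (min m n - i) * M $$ (j, i)"
      using 2 ij z diag by (intro lex_optimal_row(2)[OF opt]) auto
    then show ?thesis using 2 by simp
  next
    case 3
    have "real (min n m - i) * transpose_mat M $$ (j, i) = real (min n m - j) * transpose_mat M $$ (i, j)"
      using 3 ij z diag CM by (intro lex_optimal_row(2)[OF optT]) auto
    then show ?thesis using 3 ij CM by (simp add: min.commute)
  qed
qed

text \<open>Flipping the sign of row \<open>i\<close> would raise the objective if the diagonal
  entry were negative; a zero entry of \<open>C\<close> gives a tie, which \<open>M\<close>
  decides.\<close>

lemma lex_optimal_nonneg:
  assumes opt: "lex_optimal m n C M" and i: "i < min m n"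
  shows "C $$ (i, i) \<ge> 0" "C $$ (i, i) = 0 \<Longrightarrow> M $$ (i, i) \<ge> 0"
proof -
  have CM: "C \<in> carrier_mat m n" "M \<in> carrier_mat m n"
    using opt by (auto simp: lex_optimal_def)
  have pos: "real (min m n - i) > 0" using i by simp
  note left = lex_optimal_left[OF opt coordinate_flip_orthogonal, of i]
  note wt = weighted_trace_coordinate_flip[OF _ i]
  have "real (min m n - i) * C $$ (i, i) \<ge> 0"
    using left(1) unfolding wt[OF CM(1)] by (simp only: algebra_simps)
  then show "C $$ (i, i) \<ge> 0" using pos by (metis linorder_not_le mult_pos_neg)
  assume "C $$ (i, i) = 0"
  then have "real (min m n - i) * M $$ (i, i) \<ge> 0"
    using left(2) unfolding wt[OF CM(1)] wt[OF CM(2)] by (simp add: mult.commute)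
  then show "M $$ (i, i) \<ge> 0" using pos by (metis linorder_not_le mult_pos_neg)
qed

lemma lex_optimal_sorted:
  assumes opt: "lex_optimal m n C M" and ij: "i < j" "j < min m n"
  shows "C $$ (j, j) \<le> C $$ (i, i)"
    and "C $$ (i, i) = C $$ (j, j) \<Longrightarrow> M $$ (j, j) \<le> M $$ (i, i) \<and> M $$ (i, j) + M $$ (j, i) = 0"
proof -
  define p where "p = min m n"
  have CM: "C \<in> carrier_mat m n" "M \<in> carrier_mat m n"
    using opt by (auto simp: lex_optimal_def)
  have b: "i < min m n" "j < min m n" "i \<noteq> j" "i < m" "j < m" "i < n" "j < n" using ij by auto
  have pos: "real (p - i) - real (p - j) > 0" using ij by (simp add: p_def)
  have d: "C $$ (i, j) + C $$ (j, i) = 0"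
    using lex_optimal_diagonal[OF opt] b by simp
  note wt = weighted_trace_two_sided_plane_rotation[OF _ b(1-3), folded p_def]
  note o = opt[unfolded lex_optimal_def, THEN conjunct2, THEN conjunct2, rule_format,
      OF plane_rotation_orthogonal[OF _ b(4,5,3)] real_orthogonal_transpose[OF plane_rotation_orthogonal[OF _ b(6,7,3)]],
      folded p_def]
  \<comment> \<open>The quarter turn \<open>c = 0\<close>, \<open>s = 1\<close> exchanges the two
    diagonal entries.\<close>
  have "(real (p - i) - real (p - j)) * (C $$ (j, j) - C $$ (i, i)) \<le> 0"
    using conjunct1[OF o[of 0 1 0 1]] unfolding wt[OF CM(1), of 0 1, simplified] by simp
  then show "C $$ (j, j) \<le> C $$ (i, i)" using pos by (metis diff_le_0_iff_le linorder_not_le mult_pos_pos)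
  assume e: "C $$ (i, i) = C $$ (j, j)"
  \<comment> \<open>Equal diagonal entries make the block of \<open>C\<close> scalar, so every
    common rotation ties in the first objective and \<open>M\<close> is compared along the whole
    circle.\<close>
  have "s\<^sup>2 * (M $$ (j, j) - M $$ (i, i)) + c * s * (M $$ (i, j) + M $$ (j, i)) \<le> 0"
    if cs: "c\<^sup>2 + s\<^sup>2 = 1" for c s
  proof -
    have "(real (p - i) - real (p - j)) *
        (s\<^sup>2 * (M $$ (j, j) - M $$ (i, i)) + c * s * (M $$ (i, j) + M $$ (j, i))) \<le> 0"
      using o[OF cs cs] unfolding wt[OF CM(1) cs] wt[OF CM(2) cs] by (simp add: e d)
    then show ?thesis using pos by (metis linorder_not_le mult_pos_pos)
  qed
  from circle_quadratic_max[OF this]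
  show "M $$ (j, j) \<le> M $$ (i, i) \<and> M $$ (i, j) + M $$ (j, i) = 0" by simp
qed

section \<open>The dual singular value decomposition\<close>

lemma initial_segment_threshold:
  assumes "\<And>i j. i < j \<Longrightarrow> j < p \<Longrightarrow> P j \<Longrightarrow> P i"
  shows "\<exists>r\<le>p::nat. \<forall>i<p. P i \<longleftrightarrow> i < r"
proof -
  \<comment> \<open>The alternative \<open>i = p\<close> secures a least element when
    \<open>P\<close> holds throughout.\<close>
  define r where "r = (LEAST i. i = p \<or> (i < p \<and> \<not> P i))"
  have r: "r = p \<or> (r < p \<and> \<not> P r)"
    unfolding r_def by (rule LeastI[of _ p]) simp
  have lt: "P i" if "i < r" "i < p" for i
    using not_less_Least[OF that(1)[unfolded r_def]] that(2) by auto
  have "P i \<longleftrightarrow> i < r" if "i < p" for i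
  proof
    assume "P i"
    then show "i < r"
      using r assms[of r i] that by (metis linorder_neqE_nat)
  qed (use lt that in blast)
  then show ?thesis using r by (intro exI[of _ r]) auto
qed

lemma diagonal_mult_entry:
  assumes X: "X \<in> carrier_mat k m" and C: "C \<in> carrier_mat m n" and ij: "i < k" "j < n"
    and diag: "\<forall>i<m. \<forall>j<n. i \<noteq> j \<longrightarrow> C $$ (i, j) = (0::real)"
  shows "(X * C) $$ (i, j) = (if j < m then X $$ (i, j) * C $$ (j, j) else 0)"
proof -
  have "(X * C) $$ (i, j) = (\<Sum>q<m. X $$ (i, q) * C $$ (q, j))"
    using X C ij by (simp add: scalar_prod_def lessThan_atLeast0)
  also have "\<dots> = (\<Sum>q<m. if q = j then X $$ (i, j) * C $$ (j, j) else 0)"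
    using diag ij by (intro sum.cong) auto
  finally show ?thesis by simp
qed

lemma mult_diagonal_entry:
  assumes X: "X \<in> carrier_mat n k" and C: "C \<in> carrier_mat m n" and ij: "i < m" "j < k"
    and diag: "\<forall>i<m. \<forall>j<n. i \<noteq> j \<longrightarrow> C $$ (i, j) = (0::real)"
  shows "(C * X) $$ (i, j) = (if i < n then C $$ (i, i) * X $$ (i, j) else 0)"
proof -
  have "(C * X) $$ (i, j) = (\<Sum>q<n. C $$ (i, q) * X $$ (q, j))"
    using X C ij by (simp add: scalar_prod_def lessThan_atLeast0)
  also have "\<dots> = (\<Sum>q<n. if q = i then C $$ (i, i) * X $$ (i, j) else 0)"
    using diag ij by (intro sum.cong) auto
  finally show ?thesis by simp
qed

text \<open>First-order perturbation: skew-symmetric \<open>K\<close> and \<open>L\<close> remove the off-diagonal part of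
  the infinitesimal matrix. For \<open>i \<noteq> j\<close> the entries solve the two-by-two system
  \<open>M_ij = K_ij c_j - c_i L_ij\<close>, \<open>M_ji = - K_ij c_i + c_j L_ij\<close>, which is singular exactly when
  \<open>c_i = c_j\<close>.\<close>

lemma lex_optimal_skew_decomposition:
  assumes opt: "lex_optimal m n C M"
  shows "\<exists>K L. K \<in> carrier_mat m m \<and> L \<in> carrier_mat n n \<and>
    transpose_mat K = - K \<and> transpose_mat L = - L \<and>
    M = K * C + mat m n (\<lambda>(i, j). if i = j then M $$ (i, j) else 0) - C * L"
proof -
  define p where "p = min m n"
  \<comment> \<open>Padding \<open>c\<close> and \<open>x\<close> with zeros gives meaning to
    \<open>c i\<close> for surplus indices and to \<open>x j i\<close> when the transposed position
    lies outside the rectangle.\<close>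
  define c where "c i = (if i < p then C $$ (i, i) else 0)" for i
  define x where "x i j = (if i < m \<and> j < n then M $$ (i, j) else 0)" for i j
  \<comment> \<open>For distinct values this is Cramer's rule. For a tie \<open>l\<close> is set to
    zero and \<open>k\<close> alone removes the entry; if the common value is zero, division by zero
    makes \<open>k\<close> zero too, and there is nothing to remove.\<close>
  define k where "k i j = (if i = j then 0 else if c i = c j then x i j / c j
     else (x i j * c j + x j i * c i) / ((c j)\<^sup>2 - (c i)\<^sup>2))" for i j
  define l where "l i j = (if c i = c j then 0
     else (x i j * c i + x j i * c j) / ((c j)\<^sup>2 - (c i)\<^sup>2))" for i j
  define K where "K = mat m m (\<lambda>(i, j). k i j)"
  define L where "L = mat n n (\<lambda>(i, j). l i j)"
  have CM: "C \<in> carrier_mat m n" "M \<in> carrier_mat m n"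
    using opt by (auto simp: lex_optimal_def)
  have KL: "K \<in> carrier_mat m m" "L \<in> carrier_mat n n" by (auto simp: K_def L_def)
  have c0: "c i \<ge> 0" for i
    using lex_optimal_nonneg(1)[OF opt] by (simp add: c_def p_def)
  have sq: "(c j)\<^sup>2 - (c i)\<^sup>2 \<noteq> 0" if "c i \<noteq> c j" for i j
    using that c0[of i] c0[of j] by (simp add: power2_eq_iff_nonneg)
  \<comment> \<open>In a tie with nonzero value, skew-symmetry of \<open>k\<close> rests on the
    antisymmetry of \<open>M\<close> enforced by optimality.\<close>
  have xs: "x j i = - x i j" if "i \<noteq> j" "c i = c j" "c i \<noteq> 0" for i j
  proof -
    have ip: "i < p" "j < p" using that by (auto simp: c_def split: if_splits)
    have "x i j + x j i = 0"
    proof (cases "i < j")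
      case True
      show ?thesis using lex_optimal_sorted(2)[OF opt True] ip that
        by (simp add: x_def c_def p_def)
    next
      case False
      then have ji: "j < i" using that by simp
      show ?thesis using lex_optimal_sorted(2)[OF opt ji] ip that
        by (simp add: x_def c_def p_def add.commute)
    qed
    then show ?thesis by simp
  qed
  have ka: "k j i = - k i j" for i j
  proof (cases "i = j \<or> c i = c j")
    case True
    then show ?thesis using xs[of i j] by (cases "c i = 0") (auto simp: k_def)
  next
    case False
    have "k j i = (x j i * c i + x i j * c j) / (- ((c j)\<^sup>2 - (c i)\<^sup>2))"
      using False by (simp add: k_def)
    also have "\<dots> = - k i j"
      unfolding k_def divide_minus_right using False by (simp add: add.commute)
    finally show ?thesis .
  qed
  have la: "l j i = - l i j" for i j
  proof (cases "c i = c j")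
    case False
    have "l j i = (x j i * c j + x i j * c i) / (- ((c j)\<^sup>2 - (c i)\<^sup>2))"
      using False by (simp add: l_def)
    also have "\<dots> = - l i j"
      unfolding l_def divide_minus_right using False by (simp add: add.commute)
    finally show ?thesis .
  qed (auto simp: l_def)
  have KT: "transpose_mat K = - K" "transpose_mat L = - L"
    by (auto intro!: eq_matI ka la simp: K_def L_def)
  have diag: "\<forall>i<m. \<forall>j<n. i \<noteq> j \<longrightarrow> C $$ (i, j) = 0"
    using lex_optimal_diagonal[OF opt] by blast
  have KC: "(K * C) $$ (i, j) = k i j * c j" if "i < m" "j < n" for i j
    using diagonal_mult_entry[OF KL(1) CM(1) that diag] that
    by (auto simp: K_def c_def p_def)
  have CL: "(C * L) $$ (i, j) = c i * l i j" if "i < m" "j < n" for i j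
    using mult_diagonal_entry[OF KL(2) CM(1) that diag] that
    by (auto simp: L_def c_def p_def)
  have ent: "k i j * c j - c i * l i j = M $$ (i, j)" if ij: "i < m" "j < n" "i \<noteq> j" for i j
  proof (cases "c i = c j")
    case True
    show ?thesis
    proof (cases "c j = 0")
      case z: True
      have "M $$ (i, j) = 0"
        by (rule lex_optimal_null_block[OF opt ij]) (use z True in \<open>auto simp: c_def p_def\<close>)
      then show ?thesis using z True by simp
    next
      case False
      then show ?thesis using True ij by (simp add: k_def l_def x_def)
    qed
  next
    case False
    have "k i j * c j - c i * l i j = ((x i j * c j + x j i * c i) * c j
        - c i * (x i j * c i + x j i * c j)) / ((c j)\<^sup>2 - (c i)\<^sup>2)"
      using False ij by (simp add: k_def l_def diff_divide_distrib)
    also have "\<dots> = x i j * ((c j)\<^sup>2 - (c i)\<^sup>2) / ((c j)\<^sup>2 - (c i)\<^sup>2)"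
      by (simp add: algebra_simps power2_eq_square)
    also have "\<dots> = x i j" using sq[OF False] by simp
    finally show ?thesis using ij by (simp add: x_def)
  qed
  have "M = K * C + mat m n (\<lambda>(i, j). if i = j then M $$ (i, j) else 0) - C * L"
  proof (rule eq_matI)
    fix i j assume "i < dim_row (K * C + mat m n (\<lambda>(i, j). if i = j then M $$ (i, j) else 0) - C * L)"
      "j < dim_col (K * C + mat m n (\<lambda>(i, j). if i = j then M $$ (i, j) else 0) - C * L)"
    then have ij: "i < m" "j < n" using KL CM by auto
    have dims: "dim_row (C * L) = m" "dim_col (C * L) = n" "dim_row (K * C) = m" "dim_col (K * C) = n"
      using KL CM by auto
    have "(K * C + mat m n (\<lambda>(i, j). if i = j then M $$ (i, j) else 0) - C * L) $$ (i, j)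
      = (K * C) $$ (i, j) + (if i = j then M $$ (i, j) else 0) - (C * L) $$ (i, j)"
      using ij dims by (simp del: index_mult_mat(1))
    then show "M $$ (i, j) = (K * C + mat m n (\<lambda>(i, j). if i = j then M $$ (i, j) else 0) - C * L) $$ (i, j)"
      using ent[OF ij] by (simp add: KC[OF ij] CL[OF ij]) (auto simp: k_def l_def)
  qed (use KL CM in auto)
  then show ?thesis using KL KT by blast
qed

lemma lex_optimal_svd_sigma:
  assumes opt: "lex_optimal m n C M"
  shows "\<exists>r t. svd_sigma m n r t (C, mat m n (\<lambda>(i, j). if i = j then M $$ (i, j) else 0))"
proof -
  have CM: "C \<in> carrier_mat m n" "M \<in> carrier_mat m n"
    using opt by (auto simp: lex_optimal_def)
  note srt = lex_optimal_sorted[OF opt] and nn = lex_optimal_nonneg[OF opt]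
  have "\<exists>r\<le>min m n. \<forall>i<min m n. C $$ (i, i) > 0 \<longleftrightarrow> i < r"
    by (rule initial_segment_threshold) (use srt(1) in \<open>blast intro: less_le_trans\<close>)
  then obtain r where r: "r \<le> min m n" "\<And>i. i < min m n \<Longrightarrow> C $$ (i, i) > 0 \<longleftrightarrow> i < r"
    by blast
  \<comment> \<open>As the diagonal of \<open>C\<close> is nonnegative, the disjunction says that
    the dual entry is positive in the lexicographic order; \<open>t\<close> counts these
    entries.\<close>
  have down: "C $$ (i, i) > 0 \<or> M $$ (i, i) > 0"
    if ij: "i < j" "j < min m n" and j: "C $$ (j, j) > 0 \<or> M $$ (j, j) > 0" for i j
  proof (cases "C $$ (i, i) = C $$ (j, j)")
    case True
    then show ?thesis using srt(2)[OF ij True] j by auto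
  next
    case False
    then show ?thesis using srt(1)[OF ij] nn(1)[OF ij(2)] by linarith
  qed
  have "\<exists>t\<le>min m n. \<forall>i<min m n. C $$ (i, i) > 0 \<or> M $$ (i, i) > 0 \<longleftrightarrow> i < t"
    by (rule initial_segment_threshold) (rule down)
  then obtain t where t: "t \<le> min m n"
    "\<And>i. i < min m n \<Longrightarrow> C $$ (i, i) > 0 \<or> M $$ (i, i) > 0 \<longleftrightarrow> i < t"
    by blast
  have "r \<le> t"
  proof (rule ccontr)
    assume "\<not> r \<le> t"
    then have "t < r" "t < min m n" using r(1) by auto
    then show False using r(2)[of t] t(2)[of t] by simp
  qed
  have zero: "C $$ (i, i) = 0" if "r \<le> i" "i < min m n" for i
    using r(2)[OF that(2)] nn(1)[OF that(2)] that(1) by force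
  have zero2: "M $$ (i, i) = 0" if "t \<le> i" "i < min m n" for i
    using t(2)[OF that(2)] nn(2)[OF that(2)] zero[of i] that \<open>r \<le> t\<close> by force
  define S where "S = (C, mat m n (\<lambda>(i, j). if i = j then M $$ (i, j) else 0))"
  have ent: "dentry S i i = (C $$ (i, i), M $$ (i, i))" if "i < min m n" for i
    using that by (simp add: S_def dentry_def)
  have "dual_le (dentry S j j) (dentry S i i)" if ij: "i \<le> j" "j < t" for i j
  proof (cases "i = j")
    case False
    then have "i < j" "j < min m n" using ij t(1) by auto
    then show ?thesis
      using srt[of i j] by (auto simp: ent dual_le_def dual_less_def)
  qed (simp add: dual_le_def)
  moreover have "dentry S i j = (0, 0)" if "i < m" "j < n" "i \<noteq> j" for i j
    using that lex_optimal_diagonal[OF opt] by (simp add: S_def dentry_def)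
  moreover have "S \<in> dcarrier m n" using CM by (simp add: S_def dcarrier_def)
  moreover have "fst (dentry S i i) > 0" if "i < r" for i
    using that r(1) r(2)[of i] by (simp add: ent)
  moreover have "fst (dentry S i i) = 0 \<and> snd (dentry S i i) > 0" if "r \<le> i" "i < t" for i
    using that t(1) t(2)[of i] zero[of i] by (simp add: ent)
  moreover have "dentry S i i = (0, 0)" if "t \<le> i" "i < min m n" for i
    using that zero[of i] zero2[of i] \<open>r \<le> t\<close> by (simp add: ent)
  ultimately have "svd_sigma m n r t S"
    unfolding svd_sigma_def using \<open>r \<le> t\<close> t(1) by blast
  then show ?thesis unfolding S_def by blast
qed

text \<open>To first order \<open>I + K \<epsilon>\<close> is orthogonal exactly when
  \<open>K\<close> is skew: the infinitesimal parts of both products cancel in pairs.\<close>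

lemma dorthogonal_skew:
  assumes U: "real_orthogonal k U" and K: "K \<in> carrier_mat k k" "transpose_mat K = - K"
  shows "dorthogonal k (U, U * K)"
proof -
  have c: "U \<in> carrier_mat k k" and UU: "transpose_mat U * U = 1\<^sub>m k" "U * transpose_mat U = 1\<^sub>m k"
    using U by (auto simp: real_orthogonal_def)
  have "transpose_mat U * (U * K) = K"
    using c K UU by (simp add: mat_assoc_dim[symmetric])
  moreover have "- K * transpose_mat U * U = - K"
    using c K UU by (simp add: mat_assoc_dim)
  moreover have "K + - K = 0\<^sub>m k k"
    using K by (auto intro!: eq_matI)
  moreover have "- X + X = 0\<^sub>m k k" if "X \<in> carrier_mat k k" for X :: "real mat"
    using that by (auto intro!: eq_matI)
  moreover have "U * (- K * transpose_mat U) = - (U * K * transpose_mat U)"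
    using c K by (simp add: mat_dim_simps)
  moreover have "U * K * transpose_mat U \<in> carrier_mat k k" using c K by simp
  moreover have "transpose_mat (U * K) = - K * transpose_mat U"
    using c K by (simp add: mat_transpose_mult_dim)
  ultimately show ?thesis
    unfolding dorthogonal_def dmult_def dtrans_def done_mat_def dcarrier_def
    using c K UU by simp
qed

text \<open>The infinitesimal part of the product is \<open>U (K C + D - C L) V\<^sup>T\<close>,
  with the minus sign from the transpose of \<open>L\<close>; the bracket is \<open>M\<close>, and
  undoing the rotations returns the infinitesimal part of \<open>B\<close>.\<close>

lemma exists_dual_svd:
  assumes "B \<in> dcarrier m n"
  shows "\<exists>U S V r t. dual_svd m n B U S V r t"
proof -
  obtain Bs Bd where B: "B = (Bs, Bd)" "Bs \<in> carrier_mat m n" "Bd \<in> carrier_mat m n"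
    using assms by (cases B) (auto simp: dcarrier_def)
  obtain U V where UV: "real_orthogonal m U" "real_orthogonal n V"
    and opt: "lex_optimal m n (transpose_mat U * Bs * V) (transpose_mat U * Bd * V)"
    using exists_lex_optimal[OF B(2,3)] by blast
  define C M where "C = transpose_mat U * Bs * V" and "M = transpose_mat U * Bd * V"
  define D where "D = mat m n (\<lambda>(i, j). if i = j then M $$ (i, j) else 0)"
  have opt': "lex_optimal m n C M" using opt by (simp add: C_def M_def)
  obtain K L where KL: "K \<in> carrier_mat m m" "L \<in> carrier_mat n n"
    "transpose_mat K = - K" "transpose_mat L = - L" and M: "M = K * C + D - C * L"
    using lex_optimal_skew_decomposition[OF opt'] unfolding D_def by blast
  obtain r t where rt: "svd_sigma m n r t (C, D)"
    using lex_optimal_svd_sigma[OF opt'] unfolding D_def by blast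
  have c: "U \<in> carrier_mat m m" "V \<in> carrier_mat n n" "C \<in> carrier_mat m n" "M \<in> carrier_mat m n"
    "D \<in> carrier_mat m n"
    using UV opt' by (auto simp: real_orthogonal_def lex_optimal_def D_def)
  have undo: "U * (transpose_mat U * Z * V) * transpose_mat V = Z" if "Z \<in> carrier_mat m n" for Z
  proof -
    have "U * (transpose_mat U * Z * V) * transpose_mat V = (U * transpose_mat U) * (Z * (V * transpose_mat V))"
      using c that by (simp add: mat_dim_simps)
    also have "\<dots> = Z" using UV that by (simp add: real_orthogonal_def mat_dim_simps)
    finally show ?thesis .
  qed
  have s: "Bs = U * C * transpose_mat V" using undo[OF B(2)] by (simp add: C_def)
  have "Bd = U * M * transpose_mat V" using undo[OF B(3)] by (simp add: M_def)
  also have "\<dots> = U * (K * (C * transpose_mat V)) + U * (D * transpose_mat V) - U * (C * (L * transpose_mat V))"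
    unfolding M using c KL by (simp add: mat_dim_simps)
  also have "\<dots> = - (U * (C * (L * transpose_mat V))) + (U * (D * transpose_mat V) + U * (K * (C * transpose_mat V)))"
    using c KL by (intro eq_matI) (auto simp del: index_mult_mat(1))
  also have "\<dots> = U * C * transpose_mat (V * L) + (U * D + U * K * C) * transpose_mat V"
    using c KL by (simp add: mat_dim_simps)
  finally have "B = dmult (dmult (U, U * K) (C, D)) (dtrans (V, V * L))"
    using s by (simp add: B(1) dmult_def dtrans_def)
  then have "dual_svd m n B (U, U * K) (C, D) (V, V * L) r t"
    unfolding dual_svd_def using assms rt dorthogonal_skew[OF UV(1) KL(1,3)] dorthogonal_skew[OF UV(2) KL(2,4)]
    by simp
  then show ?thesis by blast
qed

section \<open>The essential part and the generalized Moore-Penrose inverse\<close>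

lemma dmult_carrier: "A \<in> dcarrier a b \<Longrightarrow> B \<in> dcarrier b c \<Longrightarrow> dmult A B \<in> dcarrier a c"
  by (auto simp: dcarrier_def dmult_def)

lemma dtrans_carrier: "A \<in> dcarrier a b \<Longrightarrow> dtrans A \<in> dcarrier b a"
  by (auto simp: dcarrier_def dtrans_def)

lemma dmult_assoc:
  assumes "A \<in> dcarrier a b" "B \<in> dcarrier b c" "C \<in> dcarrier c d"
  shows "dmult (dmult A B) C = dmult A (dmult B C)"
proof -
  have c: "fst A \<in> carrier_mat a b" "snd A \<in> carrier_mat a b" "fst B \<in> carrier_mat b c"
    "snd B \<in> carrier_mat b c" "fst C \<in> carrier_mat c d" "snd C \<in> carrier_mat c d"
    using assms by (auto simp: dcarrier_def)
  have "fst A * (fst B * snd C) + (fst A * (snd B * fst C) + snd A * (fst B * fst C))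
    = fst A * (fst B * snd C) + fst A * (snd B * fst C) + snd A * (fst B * fst C)"
    using c by (intro eq_matI) (auto simp del: index_mult_mat(1))
  then show ?thesis
    using c by (simp add: dmult_def mat_dim_simps)
qed

lemma dtrans_dmult:
  assumes "A \<in> dcarrier a b" "B \<in> dcarrier b c"
  shows "dtrans (dmult A B) = dmult (dtrans B) (dtrans A)"
proof -
  have c: "fst A \<in> carrier_mat a b" "snd A \<in> carrier_mat a b" "fst B \<in> carrier_mat b c"
    "snd B \<in> carrier_mat b c"
    using assms by (auto simp: dcarrier_def)
  have "transpose_mat (snd B) * transpose_mat (fst A) + transpose_mat (fst B) * transpose_mat (snd A)
    = transpose_mat (fst B) * transpose_mat (snd A) + transpose_mat (snd B) * transpose_mat (fst A)"
    by (rule comm_add_mat[of _ c a]) (use c in auto)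
  then show ?thesis
    using c by (simp add: dmult_def dtrans_def mat_dim_simps)
qed

lemma dtrans_dtrans: "dtrans (dtrans A) = A"
  by (simp add: dtrans_def)

lemma done_mat_dmult: "A \<in> dcarrier a b \<Longrightarrow> dmult (done_mat a) A = A"
  by (cases A) (auto simp: dcarrier_def dmult_def done_mat_def mat_dim_simps)

text \<open>Keeping \<open>E\<close> as a parameter covers the ordinary Moore-Penrose equations,
  where \<open>E\<close> is \<open>B\<close>, and lets a candidate for the essential part be studied
  before it is known to be unique.\<close>

definition penrose_dual :: "nat \<Rightarrow> nat \<Rightarrow> dmat \<Rightarrow> dmat \<Rightarrow> dmat \<Rightarrow> bool" where
  "penrose_dual m n B E X \<longleftrightarrow> X \<in> dcarrier n m \<and>
     dmult (dmult B X) B = E \<and> dmult (dmult X B) X = X \<and>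
     dtrans (dmult B X) = dmult B X \<and> dtrans (dmult X B) = dmult X B"

text \<open>Penrose's argument needs only that \<open>B X B\<close> and \<open>B Y B\<close> agree.
  Then \<open>B X = (B Y)(B X)\<close> and \<open>B Y = (B X)(B Y)\<close>, which are transposes of
  each other, so the symmetric matrices \<open>B X\<close> and \<open>B Y\<close> coincide; likewise
  \<open>X B\<close> and \<open>Y B\<close>. Finally \<open>X = Y B X = Y B Y = Y\<close>.\<close>

lemma penrose_dual_unique:
  assumes B: "B \<in> dcarrier m n" and "penrose_dual m n B E X" "penrose_dual m n B E Y"
  shows "X = Y"
proof -
  have X: "X \<in> dcarrier n m" "dmult (dmult B X) B = E" "dmult (dmult X B) X = X"
    "dtrans (dmult B X) = dmult B X" "dtrans (dmult X B) = dmult X B"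
    and Y: "Y \<in> dcarrier n m" "dmult (dmult B Y) B = E" "dmult (dmult Y B) Y = Y"
    "dtrans (dmult B Y) = dmult B Y" "dtrans (dmult Y B) = dmult Y B"
    using assms(2,3) by (auto simp: penrose_dual_def)
  note BX = dmult_carrier[OF B X(1)] and BY = dmult_carrier[OF B Y(1)]
    and XB = dmult_carrier[OF X(1) B] and YB = dmult_carrier[OF Y(1) B]
  have "dmult B X = dmult B (dmult (dmult X B) X)" using X(3) by simp
  also have "\<dots> = dmult (dmult (dmult B X) B) X"
    using dmult_assoc[OF B XB X(1)] dmult_assoc[OF B X(1) B] by simp
  also have "\<dots> = dmult (dmult (dmult B Y) B) X" using X(2) Y(2) by simp
  also have "\<dots> = dmult (dmult B Y) (dmult B X)" by (rule dmult_assoc[OF BY B X(1)])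
  finally have 1: "dmult B X = dmult (dmult B Y) (dmult B X)" .
  have "dmult B Y = dmult B (dmult (dmult Y B) Y)" using Y(3) by simp
  also have "\<dots> = dmult (dmult (dmult B Y) B) Y"
    using dmult_assoc[OF B YB Y(1)] dmult_assoc[OF B Y(1) B] by simp
  also have "\<dots> = dmult (dmult (dmult B X) B) Y" using X(2) Y(2) by simp
  also have "\<dots> = dmult (dmult B X) (dmult B Y)" by (rule dmult_assoc[OF BX B Y(1)])
  also have "\<dots> = dtrans (dmult (dmult B Y) (dmult B X))"
    using dtrans_dmult[OF BY BX] X(4) Y(4) by simp
  also have "\<dots> = dmult B X" using 1 X(4) by simp
  finally have left: "dmult B Y = dmult B X" .
  have "dmult X B = dmult (dmult (dmult X B) X) B" using X(3) by simp
  also have "\<dots> = dmult X (dmult (dmult B X) B)"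
    using dmult_assoc[OF XB X(1) B] dmult_assoc[OF X(1) B XB] dmult_assoc[OF B X(1) B] by simp
  also have "\<dots> = dmult X (dmult (dmult B Y) B)" using X(2) Y(2) by simp
  also have "\<dots> = dmult (dmult X B) (dmult Y B)"
    using dmult_assoc[OF X(1) B YB] dmult_assoc[OF B Y(1) B] by simp
  finally have 2: "dmult X B = dmult (dmult X B) (dmult Y B)" .
  have "dmult Y B = dmult (dmult (dmult Y B) Y) B" using Y(3) by simp
  also have "\<dots> = dmult Y (dmult (dmult B Y) B)"
    using dmult_assoc[OF YB Y(1) B] dmult_assoc[OF Y(1) B YB] dmult_assoc[OF B Y(1) B] by simp
  also have "\<dots> = dmult Y (dmult (dmult B X) B)" using X(2) Y(2) by simp
  also have "\<dots> = dmult (dmult Y B) (dmult X B)"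
    using dmult_assoc[OF Y(1) B XB] dmult_assoc[OF B X(1) B] by simp
  also have "\<dots> = dtrans (dmult (dmult X B) (dmult Y B))"
    using dtrans_dmult[OF XB YB] X(5) Y(5) by simp
  also have "\<dots> = dmult X B" using 2 X(5) by simp
  finally have right: "dmult Y B = dmult X B" .
  have "X = dmult (dmult Y B) X" using X(3) right by simp
  also have "\<dots> = dmult Y (dmult B Y)" using dmult_assoc[OF Y(1) B X(1)] left by simp
  also have "\<dots> = Y" using Y(3) dmult_assoc[OF Y(1) B Y(1)] by simp
  finally show ?thesis .
qed

lemma dorthogonal_sandwich:
  assumes "U \<in> dcarrier a m" "S \<in> dcarrier m n" "dorthogonal n V" "T \<in> dcarrier n k" "W \<in> dcarrier b k"
  shows "dmult (dmult (dmult U S) (dtrans V)) (dmult (dmult V T) (dtrans W))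
    = dmult (dmult U (dmult S T)) (dtrans W)"
proof -
  have V: "V \<in> dcarrier n n" "dmult (dtrans V) V = done_mat n"
    using assms(3) by (auto simp: dorthogonal_def)
  note Vt = dtrans_carrier[OF V(1)] and Wt = dtrans_carrier[OF assms(5)]
  note TW = dmult_carrier[OF assms(4) Wt]
  have "dmult (dmult (dmult U S) (dtrans V)) (dmult (dmult V T) (dtrans W))
    = dmult (dmult U S) (dmult (dmult (dtrans V) V) (dmult T (dtrans W)))"
    using dmult_assoc[OF dmult_carrier[OF assms(1,2)] Vt dmult_carrier[OF V(1) TW]]
      dmult_assoc[OF Vt V(1) TW] dmult_assoc[OF V(1) assms(4) Wt] by simp
  also have "\<dots> = dmult (dmult U S) (dmult T (dtrans W))"
    using V(2) done_mat_dmult[OF TW] by simp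
  also have "\<dots> = dmult (dmult U (dmult S T)) (dtrans W)"
    using dmult_assoc[OF dmult_carrier[OF assms(1,2)] assms(4) Wt]
      dmult_assoc[OF assms(1,2,4)] by simp
  finally show ?thesis .
qed

section \<open>The inverse built from a singular value decomposition\<close>

definition dunit_block :: "nat \<Rightarrow> nat \<Rightarrow> dmat" where
  "dunit_block r k = (mat k k (\<lambda>(i, j). if i = j \<and> i < r then 1 else 0), 0\<^sub>m k k)"

text \<open>The diagonal entries are the dual number inverses
  \<open>(a + b \<epsilon>)\<inverse> = a\<inverse> - (b / a\<^sup>2) \<epsilon>\<close>.\<close>

definition dsigma_inverse :: "nat \<Rightarrow> nat \<Rightarrow> nat \<Rightarrow> dmat \<Rightarrow> dmat" where
  "dsigma_inverse m n r S =
    (mat n m (\<lambda>(i, j). if i = j \<and> i < r then 1 / fst S $$ (i, i) else 0),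
     mat n m (\<lambda>(i, j). if i = j \<and> i < r then - snd S $$ (i, i) / (fst S $$ (i, i))\<^sup>2 else 0))"

text \<open>Only the appreciable diagonal entries are invertible dual numbers, so products with
  \<open>T\<close> are truncated identities, and these cut \<open>S\<close> down to its first
  \<open>r\<close> diagonal entries.\<close>

lemma svd_sigma_products:
  assumes sig: "svd_sigma m n r t S"
  defines "T \<equiv> dsigma_inverse m n r S"
  shows "dmult S T = dunit_block r m" "dmult T S = dunit_block r n"
    "dmult (dunit_block r m) S = dtrunc r S" "dmult (dunit_block r n) T = T"
    "fst (dtrunc r S) = fst S"
proof -
  obtain C D where S: "S = (C, D)" by (cases S)
  have CD: "C \<in> carrier_mat m n" "D \<in> carrier_mat m n" and r: "r \<le> m" "r \<le> n"
    and diag: "\<forall>i<m. \<forall>j<n. i \<noteq> j \<longrightarrow> C $$ (i, j) = 0" "\<forall>i<m. \<forall>j<n. i \<noteq> j \<longrightarrow> D $$ (i, j) = 0"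
    and pos: "\<And>i. i < r \<Longrightarrow> C $$ (i, i) > 0"
    using sig by (auto simp: svd_sigma_def S dcarrier_def dentry_def)
  have zero: "C $$ (i, i) = 0" if "r \<le> i" "i < m" "i < n" for i
    using sig that by (cases "i < t") (auto simp: svd_sigma_def S dentry_def)
  define Ts where "Ts = mat n m (\<lambda>(i, j). if i = j \<and> i < r then 1 / C $$ (i, i) else 0)"
  define Td where "Td = mat n m (\<lambda>(i, j). if i = j \<and> i < r then - D $$ (i, i) / (C $$ (i, i))\<^sup>2 else 0)"
  have T: "T = (Ts, Td)" unfolding T_def dsigma_inverse_def S Ts_def Td_def fst_conv snd_conv ..
  have TT: "Ts \<in> carrier_mat n m" "Td \<in> carrier_mat n m" by (auto simp: Ts_def Td_def)
  define J where "J k = mat k k (\<lambda>(i, j). if i = j \<and> i < r then 1 else (0::real))" for k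
  have J: "J k \<in> carrier_mat k k" "\<forall>i<k. \<forall>j<k. i \<noteq> j \<longrightarrow> J k $$ (i, j) = 0" for k
    by (auto simp: J_def)
  have DJ: "dunit_block r k = (J k, 0\<^sub>m k k)" for k by (simp add: dunit_block_def J_def)
  have "C * Ts = J m"
  proof (rule eq_matI)
    fix i j assume "i < dim_row (J m)" "j < dim_col (J m)"
    then have ij: "i < m" "j < m" by (auto simp: J_def)
    show "(C * Ts) $$ (i, j) = J m $$ (i, j)"
      unfolding mult_diagonal_entry[OF TT(1) CD(1) ij diag(1)]
      using ij r pos[of i] by (auto simp: J_def Ts_def)
  qed (use CD TT in \<open>auto simp: J_def\<close>)
  moreover have "C * Td + D * Ts = 0\<^sub>m m m"
  proof (rule eq_matI)
    fix i j assume "i < dim_row (0\<^sub>m m m)" "j < dim_col (0\<^sub>m m m)"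
    then have ij: "i < m" "j < m" by auto
    have "(C * Td + D * Ts) $$ (i, j) = (C * Td) $$ (i, j) + (D * Ts) $$ (i, j)"
      using ij CD TT by (simp del: index_mult_mat(1))
    then show "(C * Td + D * Ts) $$ (i, j) = 0\<^sub>m m m $$ (i, j)"
      unfolding mult_diagonal_entry[OF TT(1) CD(2) ij diag(2)] mult_diagonal_entry[OF TT(2) CD(1) ij diag(1)]
      using ij r pos[of i] by (auto simp: Ts_def Td_def power2_eq_square)
  qed (use CD TT in auto)
  ultimately show "dmult S T = dunit_block r m"
    by (simp add: S T DJ dmult_def)
  have "Ts * C = J n"
  proof (rule eq_matI)
    fix i j assume "i < dim_row (J n)" "j < dim_col (J n)"
    then have ij: "i < n" "j < n" by (auto simp: J_def)
    show "(Ts * C) $$ (i, j) = J n $$ (i, j)"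
      unfolding diagonal_mult_entry[OF TT(1) CD(1) ij diag(1)]
      using ij r pos[of i] by (auto simp: J_def Ts_def)
  qed (use CD TT in \<open>auto simp: J_def\<close>)
  moreover have "Ts * D + Td * C = 0\<^sub>m n n"
  proof (rule eq_matI)
    fix i j assume "i < dim_row (0\<^sub>m n n)" "j < dim_col (0\<^sub>m n n)"
    then have ij: "i < n" "j < n" by auto
    have "(Ts * D + Td * C) $$ (i, j) = (Ts * D) $$ (i, j) + (Td * C) $$ (i, j)"
      using ij CD TT by (simp del: index_mult_mat(1))
    then show "(Ts * D + Td * C) $$ (i, j) = 0\<^sub>m n n $$ (i, j)"
      unfolding diagonal_mult_entry[OF TT(1) CD(2) ij diag(2)] diagonal_mult_entry[OF TT(2) CD(1) ij diag(1)]
      using ij r pos[of i] by (auto simp: Ts_def Td_def power2_eq_square)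
  qed (use CD TT in auto)
  ultimately show "dmult T S = dunit_block r n"
    by (simp add: S T DJ dmult_def)
  have JX: "J k * X = mat k l (\<lambda>(i, j). if i < r then X $$ (i, j) else 0)"
    if X: "X \<in> carrier_mat k l" for k l X
  proof (rule eq_matI)
    fix i j assume "i < dim_row (mat k l (\<lambda>(i, j). if i < r then X $$ (i, j) else 0))"
      "j < dim_col (mat k l (\<lambda>(i, j). if i < r then X $$ (i, j) else 0))"
    then have ij: "i < k" "j < l" by auto
    show "(J k * X) $$ (i, j) = mat k l (\<lambda>(i, j). if i < r then X $$ (i, j) else 0) $$ (i, j)"
      unfolding mult_diagonal_entry[OF X J(1) ij J(2)] using ij by (simp add: J_def)
  qed (use X in \<open>auto simp: J_def\<close>)
  have JX0: "J k * X + 0\<^sub>m k k * Y = J k * X" if "X \<in> carrier_mat k l" "Y \<in> carrier_mat k l" for k l X Y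
    using that J(1)[of k] by (intro eq_matI) (auto simp del: index_mult_mat(1) simp: mat_zero_mult_dim)
  have "J m * C = fst (dtrunc r S)" "J m * D = snd (dtrunc r S)"
    unfolding JX[OF CD(1)] JX[OF CD(2)] using CD diag by (auto intro!: eq_matI simp: S dtrunc_def)
  then show "dmult (dunit_block r m) S = dtrunc r S"
    using JX0[OF CD(2,1)] by (simp add: S DJ dmult_def)
  have "J n * Ts = Ts" "J n * Td = Td"
    unfolding JX[OF TT(1)] JX[OF TT(2)] by (auto intro!: eq_matI simp: Ts_def Td_def)
  then show "dmult (dunit_block r n) T = T"
    using JX0[OF TT(2,1)] by (simp add: T DJ dmult_def)
  \<comment> \<open>Beyond index \<open>r\<close> the diagonal is infinitesimal or zero, so
    truncation leaves the standard part alone.\<close>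
  have "C $$ (i, j) = 0" if "i < m" "j < n" "\<not> (i = j \<and> i < r)" for i j
    using that diag(1) zero[of i] by (cases "i = j") auto
  then show "fst (dtrunc r S) = fst S"
    using CD by (auto intro!: eq_matI simp: S dtrunc_def)
qed

text \<open>With \<open>X = V T U\<^sup>T\<close> the orthogonal factors cancel in every product,
  and the Penrose equations reduce to those between the diagonal matrices.\<close>

lemma dual_svd_penrose:
  assumes svd: "dual_svd m n B U S V r t"
  defines "E \<equiv> dmult (dmult U (dtrunc r S)) (dtrans V)"
  shows "\<exists>X. penrose_dual m n B E X" "fst E = fst B"
proof -
  define T where "T = dsigma_inverse m n r S"
  define X where "X = dmult (dmult V T) (dtrans U)"
  have U: "dorthogonal m U" "U \<in> dcarrier m m" and V: "dorthogonal n V" "V \<in> dcarrier n n"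
    and S: "svd_sigma m n r t S" "S \<in> dcarrier m n" and B: "B = dmult (dmult U S) (dtrans V)"
    using svd by (auto simp: dual_svd_def dorthogonal_def svd_sigma_def)
  have T: "T \<in> dcarrier n m" by (simp add: T_def dsigma_inverse_def dcarrier_def)
  note prod = svd_sigma_products[OF S(1), folded T_def]
  have J: "dunit_block r k \<in> dcarrier k k" "dtrans (dunit_block r k) = dunit_block r k" for k
    by (auto simp: dunit_block_def dcarrier_def dtrans_def intro!: eq_matI)
  have BX: "dmult B X = dmult (dmult U (dunit_block r m)) (dtrans U)"
    unfolding B X_def using dorthogonal_sandwich[OF U(2) S(2) V(1) T U(2)] prod(1) by simp
  have XB: "dmult X B = dmult (dmult V (dunit_block r n)) (dtrans V)"
    unfolding B X_def using dorthogonal_sandwich[OF V(2) T U(1) S(2) V(2)] prod(2) by simp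
  have sym: "dtrans (dmult (dmult W (dunit_block r k)) (dtrans W)) = dmult (dmult W (dunit_block r k)) (dtrans W)"
    if W: "W \<in> dcarrier k k" for W k
    using dtrans_dmult[OF dmult_carrier[OF W J(1)] dtrans_carrier[OF W]] dtrans_dmult[OF W J(1)]
      dmult_assoc[OF W J(1) dtrans_carrier[OF W]]
    by (simp add: dtrans_dtrans J(2))
  have "dmult (dmult B X) B = E"
    unfolding BX E_def unfolding B
    using dorthogonal_sandwich[OF U(2) J(1) U(1) S(2) V(2)] prod(3) by simp
  moreover have "dmult (dmult X B) X = X"
    unfolding XB unfolding X_def
    using dorthogonal_sandwich[OF V(2) J(1) V(1) T U(2)] prod(4) by simp
  moreover have "X \<in> dcarrier n m"
    unfolding X_def by (intro dmult_carrier[OF dmult_carrier[OF V(2) T] dtrans_carrier[OF U(2)]])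
  ultimately have "penrose_dual m n B E X"
    unfolding penrose_dual_def using sym[OF U(2)] sym[OF V(2)] BX XB by simp
  then show "\<exists>X. penrose_dual m n B E X" by blast
  show "fst E = fst B"
    unfolding E_def B using prod(5) by (simp add: dmult_def)
qed

section \<open>The real Moore-Penrose inverse and the form of the essential part\<close>

lemma mat_add_left_cancel:
  fixes X Y Z :: "real mat"
  assumes "X + Y = X + Z" "X \<in> carrier_mat m n" "Y \<in> carrier_mat m n" "Z \<in> carrier_mat m n"
  shows "Y = Z"
proof (rule eq_matI)
  fix i j assume "i < dim_row Z" "j < dim_col Z"
  then show "Y $$ (i, j) = Z $$ (i, j)"
    using arg_cong[OF assms(1), of "\<lambda>A. A $$ (i, j)"] assms(2-4) by simp
qed (use assms in auto)

text \<open>Real matrices embed as dual matrices with zero infinitesimal part, so uniqueness is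
  inherited from the dual case.\<close>

lemma mp_inv_eqI:
  assumes A: "A \<in> carrier_mat m n" and X: "X \<in> carrier_mat n m" "A * X * A = A" "X * A * X = X"
    "transpose_mat (A * X) = A * X" "transpose_mat (X * A) = X * A"
  shows "mp_inv A = X"
  unfolding mp_inv_def
proof (rule the_equality)
  have dims: "dim_row A = m" "dim_col A = n" using A by auto
  show "X \<in> carrier_mat (dim_col A) (dim_row A) \<and> A * X * A = A \<and> X * A * X = X \<and>
      transpose_mat (A * X) = A * X \<and> transpose_mat (X * A) = X * A"
    using X dims by simp
  fix Y assume "Y \<in> carrier_mat (dim_col A) (dim_row A) \<and> A * Y * A = A \<and> Y * A * Y = Y \<and>
      transpose_mat (A * Y) = A * Y \<and> transpose_mat (Y * A) = Y * A"
  then have Y: "Y \<in> carrier_mat n m" "A * Y * A = A" "Y * A * Y = Y"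
    "transpose_mat (A * Y) = A * Y" "transpose_mat (Y * A) = Y * A"
    using dims by auto
  have lift: "dmult (P, 0\<^sub>m a b) (Q, 0\<^sub>m b c) = (P * Q, 0\<^sub>m a c)"
    if "P \<in> carrier_mat a b" "Q \<in> carrier_mat b c" for P Q :: "real mat" and a b c
    using that by (simp add: dmult_def mat_zero_mult_dim mat_mult_zero_dim)
  have "penrose_dual m n (A, 0\<^sub>m m n) (A, 0\<^sub>m m n) (Z, 0\<^sub>m n m)"
    if Z: "Z \<in> carrier_mat n m" "A * Z * A = A" "Z * A * Z = Z"
    "transpose_mat (A * Z) = A * Z" "transpose_mat (Z * A) = Z * A" for Z
  proof -
    have AZ: "A * Z \<in> carrier_mat m m" "Z * A \<in> carrier_mat n n" using A Z(1) by auto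
    show ?thesis
      unfolding penrose_dual_def lift[OF A Z(1)] lift[OF Z(1) A] lift[OF AZ(1) A] lift[OF AZ(2) Z(1)]
      using Z by (simp add: dcarrier_def dtrans_def)
  qed
  from penrose_dual_unique[OF _ this[OF Y] this[OF X]] A show "Y = X"
    by (simp add: dcarrier_def)
qed

text \<open>Existence comes from the decomposition of \<open>(A, 0)\<close>: the standard part of
  its dual inverse satisfies the real equations, because truncation preserves the standard
  part.\<close>

lemma mp_inv_penrose:
  assumes A: "A \<in> carrier_mat m n"
  shows "mp_inv A \<in> carrier_mat n m" "A * mp_inv A * A = A" "mp_inv A * A * mp_inv A = mp_inv A"
    "transpose_mat (A * mp_inv A) = A * mp_inv A" "transpose_mat (mp_inv A * A) = mp_inv A * A"
proof -
  have "(A, 0\<^sub>m m n) \<in> dcarrier m n" using A by (simp add: dcarrier_def)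
  then obtain U S V r t where "dual_svd m n (A, 0\<^sub>m m n) U S V r t"
    using exists_dual_svd by blast
  from dual_svd_penrose[OF this] obtain E X where
    X: "penrose_dual m n (A, 0\<^sub>m m n) E X" and E: "fst E = A" unfolding fst_conv by blast
  have p: "fst X \<in> carrier_mat n m" "A * fst X * A = A" "fst X * A * fst X = fst X"
    "transpose_mat (A * fst X) = A * fst X" "transpose_mat (fst X * A) = fst X * A"
    using X E by (cases X; cases E; simp add: penrose_dual_def dcarrier_def dmult_def dtrans_def)+
  have "mp_inv A = fst X" using mp_inv_eqI[OF A p] .
  then show "mp_inv A \<in> carrier_mat n m" "A * mp_inv A * A = A" "mp_inv A * A * mp_inv A = mp_inv A"
    "transpose_mat (A * mp_inv A) = A * mp_inv A" "transpose_mat (mp_inv A * A) = mp_inv A * A"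
    using p by auto
qed

lemma penrose_dual_std:
  assumes "B \<in> dcarrier m n" "penrose_dual m n B E X" "fst E = fst B"
  shows "fst X = mp_inv (fst B)"
proof -
  have "fst B \<in> carrier_mat m n" using assms(1) by (simp add: dcarrier_def)
  moreover have "fst X \<in> carrier_mat n m" "fst B * fst X * fst B = fst B" "fst X * fst B * fst X = fst X"
    "transpose_mat (fst B * fst X) = fst B * fst X" "transpose_mat (fst X * fst B) = fst X * fst B"
    using assms by (cases X; cases E; cases B; simp add: penrose_dual_def dcarrier_def dmult_def dtrans_def)+
  ultimately show ?thesis using mp_inv_eqI by metis
qed

text \<open>Since \<open>B X E = E = B X B\<close> and \<open>E X B = E = B X B\<close>, the essential part agrees with \<open>B\<close> after
  multiplication with either projector, which leaves no choice for its infinitesimal part.\<close>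

lemma penrose_dual_infinitesimal:
  assumes B: "B \<in> dcarrier m n" and X: "penrose_dual m n B E X" and E: "fst E = fst B"
  defines "P \<equiv> fst B * mp_inv (fst B)" and "Q \<equiv> mp_inv (fst B) * fst B"
  shows "snd E = P * snd B + snd B * Q - P * snd B * Q"
proof -
  have Xc: "X \<in> dcarrier n m" and XE: "dmult (dmult B X) B = E" and XX: "dmult (dmult X B) X = X"
    using X by (auto simp: penrose_dual_def)
  define W where "W = fst B * snd X + snd B * fst X"
  define Z where "Z = fst X * snd B + snd X * fst B"
  have c: "fst B \<in> carrier_mat m n" "snd B \<in> carrier_mat m n" "fst X \<in> carrier_mat n m"
    "snd X \<in> carrier_mat n m"
    using B Xc by (auto simp: dcarrier_def)
  have G: "fst X = mp_inv (fst B)" by (rule penrose_dual_std[OF B X E])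
  have BX: "dmult B X = (P, W)" and XB: "dmult X B = (Q, Z)"
    by (auto simp: dmult_def P_def Q_def W_def Z_def G)
  have cPQ: "P \<in> carrier_mat m m" "W \<in> carrier_mat m m" "Q \<in> carrier_mat n n" "Z \<in> carrier_mat n n"
    using c by (auto simp: P_def Q_def W_def Z_def G[symmetric])
  have BQ: "fst B * Q = fst B"
    using mp_inv_penrose(2)[OF c(1)] c unfolding Q_def G[symmetric] by (simp add: mat_assoc_dim)
  have Es: "snd E = P * snd B + W * fst B"
    using XE unfolding BX by (auto simp: dmult_def)
  have cE: "snd E \<in> carrier_mat m n" using Es cPQ c by simp
  \<comment> \<open>Regrouping \<open>B X B X B\<close> brings out the factor \<open>X B X\<close>,
    which is \<open>X\<close>.\<close>
  have "dmult E (dmult X B) = dmult B (dmult X B)"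
  proof -
    note XBc = dmult_carrier[OF Xc B] and BXc = dmult_carrier[OF B Xc]
    have "dmult E (dmult X B) = dmult (dmult B X) (dmult B (dmult X B))"
      unfolding XE[symmetric] by (rule dmult_assoc[OF BXc B XBc])
    also have "\<dots> = dmult B (dmult (dmult (dmult X B) X) B)"
      using dmult_assoc[OF B Xc dmult_carrier[OF B XBc]] dmult_assoc[OF XBc Xc B]
        dmult_assoc[OF Xc B XBc] by simp
    finally show ?thesis using XX by simp
  qed
  then have "fst B * Z + snd E * Q = fst B * Z + snd B * Q"
    unfolding XB by (simp add: dmult_def E)
  moreover have "fst B * Z \<in> carrier_mat m n" "snd E * Q \<in> carrier_mat m n" "snd B * Q \<in> carrier_mat m n"
    using c cPQ cE by auto
  ultimately have EQ: "snd E * Q = snd B * Q"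
    by (metis mat_add_left_cancel)
  \<comment> \<open>Multiplying \<open>Es\<close> by \<open>Q\<close> on the right fixes
    \<open>W * fst B\<close>, since \<open>fst B * Q = fst B\<close>. This expresses it through
    \<open>snd B\<close> and removes the unknown \<open>snd X\<close> hidden in
    \<open>W\<close>.\<close>
  have "snd B * Q = P * snd B * Q + W * fst B"
    unfolding EQ[symmetric] unfolding Es using c cPQ BQ by (simp add: mat_dim_simps)
  moreover have "X1 + X2 = X1 + (X3 + X2) - X3"
    if "X1 \<in> carrier_mat m n" "X2 \<in> carrier_mat m n" "X3 \<in> carrier_mat m n" for X1 X2 X3 :: "real mat"
    using that by (intro eq_matI) auto
  ultimately show ?thesis
    unfolding Es using c cPQ by (metis mult_carrier_mat)
qed

text \<open>The infinitesimal part equals \<open>B\<^sub>d - (I - P) B\<^sub>d (I - Q)\<close>: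
  exactly the block outside both projectors is deleted.\<close>

definition ess_formula :: "dmat \<Rightarrow> dmat" where
  "ess_formula B = (let P = fst B * mp_inv (fst B); Q = mp_inv (fst B) * fst B
     in (fst B, P * snd B + snd B * Q - P * snd B * Q))"

lemma dual_svd_ess:
  assumes svd: "dual_svd m n B U S V r t"
  shows "dmult (dmult U (dtrunc r S)) (dtrans V) = ess_formula B"
proof -
  have B: "B \<in> dcarrier m n" using svd unfolding dual_svd_def by blast
  obtain X where X: "penrose_dual m n B (dmult (dmult U (dtrunc r S)) (dtrans V)) X"
    using dual_svd_penrose(1)[OF svd] by blast
  show ?thesis
    using penrose_dual_infinitesimal[OF B X dual_svd_penrose(2)[OF svd]] dual_svd_penrose(2)[OF svd]
    by (simp add: ess_formula_def Let_def prod_eq_iff)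
qed

text \<open>Every decomposition yields the same truncated product, as the formula depends on
  \<open>B\<close> alone; this justifies the definite description.\<close>

lemma ess_part_eq:
  assumes B: "B \<in> dcarrier m n"
  shows "ess_part B = ess_formula B"
proof -
  have dims: "dim_row (fst B) = m" "dim_col (fst B) = n" using B by (auto simp: dcarrier_def)
  obtain U S V r t where svd: "dual_svd m n B U S V r t"
    using exists_dual_svd[OF B] by blast
  show ?thesis
    unfolding ess_part_def dims
    by (rule the_equality) (use svd dual_svd_ess in \<open>metis+\<close>)
qed

lemma gmpi_penrose:
  assumes B: "B \<in> dcarrier m n"
  shows "penrose_dual m n B (ess_formula B) (gmpi B)"
    and "penrose_dual m n B (ess_formula B) X \<Longrightarrow> gmpi B = X"
proof -
  have dims: "dim_row (fst B) = m" "dim_col (fst B) = n" using B by (auto simp: dcarrier_def)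
  have g: "gmpi B = (THE X. penrose_dual m n B (ess_formula B) X)"
    unfolding gmpi_def dims ess_part_eq[OF B] penrose_dual_def ..
  have ex: "\<exists>X. penrose_dual m n B (ess_formula B) X"
    using exists_dual_svd[OF B] dual_svd_penrose(1) dual_svd_ess by metis
  then show "penrose_dual m n B (ess_formula B) (gmpi B)"
    unfolding g using penrose_dual_unique[OF B] by (metis theI)
  show "penrose_dual m n B (ess_formula B) X \<Longrightarrow> gmpi B = X"
    unfolding g using penrose_dual_unique[OF B] by blast
qed

section \<open>Comparison of the two dual inverses\<close>

lemma mat_minus_eq_zero_iff:
  fixes X Y :: "real mat"
  assumes "X \<in> carrier_mat m n" "Y \<in> carrier_mat m n"
  shows "X - Y = 0\<^sub>m m n \<longleftrightarrow> X = Y"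
proof
  assume e: "X - Y = 0\<^sub>m m n"
  show "X = Y"
  proof (rule eq_matI)
    fix i j assume "i < dim_row Y" "j < dim_col Y"
    then show "X $$ (i, j) = Y $$ (i, j)"
      using arg_cong[OF e, of "\<lambda>A. A $$ (i, j)"] assms by simp
  qed (use assms in auto)
qed (use assms in \<open>auto intro!: eq_matI\<close>)

lemma projector_conditions_iff:
  fixes P Q Ad :: "real mat"
  assumes "P \<in> carrier_mat m m" "Q \<in> carrier_mat n n" "Ad \<in> carrier_mat m n"
  shows "P * Ad * (1\<^sub>m n - Q) = 0\<^sub>m m n \<longleftrightarrow> P * Ad = P * Ad * Q"
    and "(1\<^sub>m m - P) * Ad * Q = 0\<^sub>m m n \<longleftrightarrow> Ad * Q = P * Ad * Q"
proof -
  have e: "P * Ad * (1\<^sub>m n - Q) = P * Ad - P * Ad * Q" "(1\<^sub>m m - P) * Ad * Q = Ad * Q - P * Ad * Q"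
    using assms by (auto simp: mat_dim_simps)
  show "P * Ad * (1\<^sub>m n - Q) = 0\<^sub>m m n \<longleftrightarrow> P * Ad = P * Ad * Q"
    "(1\<^sub>m m - P) * Ad * Q = 0\<^sub>m m n \<longleftrightarrow> Ad * Q = P * Ad * Q"
    unfolding e by (rule mat_minus_eq_zero_iff; use assms in auto)+
qed

lemma mp_inv_projectors:
  assumes A: "A \<in> carrier_mat m n"
  defines "G \<equiv> mp_inv A"
  defines "P \<equiv> A * G" and "Q \<equiv> G * A"
  shows "P \<in> carrier_mat m m" "Q \<in> carrier_mat n n" "P * A = A" "A * Q = A" "Q * G = G" "G * P = G"
    "P * P = P" "Q * Q = Q" "transpose_mat P = P" "transpose_mat Q = Q"
proof -
  note G = mp_inv_penrose[OF A, folded G_def]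
  show "P \<in> carrier_mat m m" "Q \<in> carrier_mat n n" "P * A = A" "Q * G = G"
    "transpose_mat P = P" "transpose_mat Q = Q"
    using G A by (auto simp: P_def Q_def)
  show AQ: "A * Q = A" and GP: "G * P = G"
    using G A by (auto simp: P_def Q_def mat_assoc_dim)
  show "P * P = P"
    unfolding P_def using GP G(1) A by (simp add: P_def mat_assoc_dim)
  show "Q * Q = Q"
    unfolding Q_def using AQ G(1) A by (simp add: Q_def mat_assoc_dim)
qed

text \<open>\<open>W\<close> and \<open>Z\<close> are the infinitesimal parts of the two products
  with the MPDGI. From \<open>P * W = 0\<close> and \<open>W * P = W\<close>, symmetry of
  \<open>W\<close> gives that \<open>W\<close> is the transpose of \<open>P * W\<close>, hence zero;
  \<open>Z\<close> is treated in the mirrored way with \<open>Q\<close>.\<close>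

lemma gmpi_eq_mpdgi_iff:
  assumes A: "As \<in> carrier_mat m n" and Ad: "Ad \<in> carrier_mat m n"
  defines "G \<equiv> mp_inv As"
  defines "P \<equiv> As * G" and "Q \<equiv> G * As"
  shows "gmpi (As, Ad) = mpdgi (As, Ad) \<longleftrightarrow> P * Ad = P * Ad * Q \<and> Ad * Q = P * Ad * Q"
proof -
  note G = mp_inv_penrose[OF A, folded G_def]
  note pr = mp_inv_projectors[OF A, folded G_def, folded P_def Q_def]
  have B: "(As, Ad) \<in> dcarrier m n" using A Ad by (simp add: dcarrier_def)
  define Y where "Y = (G, - (G * Ad * G))"
  have Y: "mpdgi (As, Ad) = Y" by (simp add: mpdgi_def Y_def G_def)
  define W where "W = Ad * G - P * Ad * G"
  define Z where "Z = G * Ad - G * Ad * Q"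
  have cW: "W \<in> carrier_mat m m" "Z \<in> carrier_mat n n"
    using A Ad G(1) pr(1,2) by (auto simp: W_def Z_def)
  have "As * (- (G * Ad * G)) + Ad * G = - (As * (G * Ad * G)) + Ad * G"
    using A Ad G(1) by simp
  also have "\<dots> = - (P * Ad * G) + Ad * G"
    using A Ad G(1) by (simp add: P_def mat_assoc_dim)
  also have "\<dots> = W"
    using A Ad G(1) pr(1) unfolding W_def by (intro eq_matI) (auto simp del: index_mult_mat(1))
  finally have AY: "dmult (As, Ad) Y = (P, W)"
    by (simp add: dmult_def Y_def P_def)
  have "G * Ad + - (G * Ad * G) * As = G * Ad + - (G * Ad * G * As)"
    using A Ad G(1) by simp
  also have "\<dots> = G * Ad + - (G * Ad * Q)"
    using A Ad G(1) by (simp add: Q_def mat_assoc_dim)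
  also have "\<dots> = Z"
    using A Ad G(1) pr(2) unfolding Z_def by (intro eq_matI) (auto simp del: index_mult_mat(1))
  finally have YA: "dmult Y (As, Ad) = (Q, Z)"
    by (simp add: dmult_def Y_def Q_def)
  have PP: "P * (P * X) = P * X" if "X \<in> carrier_mat m k" for X k
    using that pr(1,7) by (simp add: mat_assoc_dim[symmetric])
  have QQ: "Q * (G * X) = G * X" if "X \<in> carrier_mat m k" for X k
    using that pr(2,5) G(1) by (simp add: mat_assoc_dim[symmetric])
  have "P * W = P * (Ad * G) - P * (P * (Ad * G))"
    unfolding W_def using A Ad G(1) pr(1) by (simp add: mat_dim_simps)
  also have "\<dots> = 0\<^sub>m m m"
    using Ad G(1) pr(1) by (subst PP[of _ m]) (auto intro!: minus_r_inv_mat)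
  finally have PW: "P * W = 0\<^sub>m m m" .
  have WP: "W * P = W"
    unfolding W_def using Ad G(1) pr(1,6) by (simp add: mat_dim_simps)
  have "Z * Q = G * (Ad * Q) - G * (Ad * (Q * Q))"
    unfolding Z_def using Ad G(1) pr(2) by (simp add: mat_dim_simps)
  also have "\<dots> = 0\<^sub>m n n"
    unfolding pr(8) using Ad G(1) pr(2) by (intro minus_r_inv_mat) auto
  finally have ZQ: "Z * Q = 0\<^sub>m n n" .
  have QZ: "Q * Z = Z"
    unfolding Z_def using Ad G(1) pr(2) QQ[of _ n] by (simp add: mat_dim_simps)
  show ?thesis
  proof
    assume "gmpi (As, Ad) = mpdgi (As, Ad)"
    then have "penrose_dual m n (As, Ad) (ess_formula (As, Ad)) Y"
      using gmpi_penrose(1)[OF B] Y by simp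
    then have "transpose_mat W = W" "transpose_mat Z = Z"
      unfolding penrose_dual_def AY YA by (auto simp: dtrans_def)
    then have "W * P = transpose_mat (P * W)" "Q * Z = transpose_mat (Z * Q)"
      using cW pr(1,2,9,10) by (simp_all add: mat_transpose_mult_dim)
    then have "W = 0\<^sub>m m m" "Z = 0\<^sub>m n n"
      unfolding WP QZ PW ZQ by auto
    then have W: "Ad * G = P * Ad * G" and Z: "G * Ad = G * Ad * Q"
      using mat_minus_eq_zero_iff[of "Ad * G" m m "P * Ad * G"] mat_minus_eq_zero_iff[of "G * Ad" n n "G * Ad * Q"]
        Ad G(1) pr(1,2) unfolding W_def Z_def by (metis mult_carrier_mat)+
    \<comment> \<open>Multiplication by \<open>As\<close> turns \<open>G\<close> into a projector
      and the vanishing of \<open>W\<close> and \<open>Z\<close> into the two conditions.\<close>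
    have "Ad * Q = (Ad * G) * As"
      using Ad A G(1) by (simp add: Q_def mat_assoc_dim)
    also have "\<dots> = (P * Ad * G) * As" by (rule arg_cong[OF W])
    also have "\<dots> = P * Ad * Q"
      using Ad A G(1) pr(1) by (simp add: Q_def mat_assoc_dim)
    finally have 1: "Ad * Q = P * Ad * Q" .
    have "P * Ad = As * (G * Ad)"
      using Ad A G(1) by (simp add: P_def mat_assoc_dim)
    also have "\<dots> = As * (G * Ad * Q)" by (rule arg_cong[OF Z])
    also have "\<dots> = P * Ad * Q"
      using Ad A G(1) pr(2) by (simp add: P_def mat_assoc_dim)
    finally show "P * Ad = P * Ad * Q \<and> Ad * Q = P * Ad * Q" using 1 by blast
  next
    assume H: "P * Ad = P * Ad * Q \<and> Ad * Q = P * Ad * Q"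
    \<comment> \<open>Conversely, inserting \<open>G = Q * G\<close> and, further down,
      \<open>G = G * P\<close> brings the conditions into play.\<close>
    have "Ad * G = (Ad * Q) * G" using Ad G(1) pr(2,5) by (simp add: mat_assoc_dim)
    also have "\<dots> = (P * Ad * Q) * G" by (rule arg_cong[OF conjunct2[OF H]])
    also have "\<dots> = P * Ad * G" using Ad G(1) pr(1,2,5) by (simp add: mat_assoc_dim)
    finally have "Ad * G = P * Ad * G" .
    moreover have "Ad * G \<in> carrier_mat m m" "P * Ad * G \<in> carrier_mat m m"
      using Ad G(1) pr(1) by auto
    ultimately have W0: "W = 0\<^sub>m m m"
      unfolding W_def using mat_minus_eq_zero_iff by blast
    have "G * Ad = G * (P * Ad)" using Ad G(1) pr(1,6) by (simp add: mat_assoc_dim[symmetric])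
    also have "\<dots> = G * (P * Ad * Q)" by (rule arg_cong[OF conjunct1[OF H]])
    also have "\<dots> = (G * P) * Ad * Q" using Ad G(1) pr(1,2) by (simp add: mat_assoc_dim)
    also have "\<dots> = G * Ad * Q" using pr(6) by simp
    finally have "G * Ad = G * Ad * Q" .
    moreover have "G * Ad \<in> carrier_mat n n" "G * Ad * Q \<in> carrier_mat n n"
      using Ad G(1) pr(2) by auto
    ultimately have Z0: "Z = 0\<^sub>m n n"
      unfolding Z_def using mat_minus_eq_zero_iff by blast
    have cP: "P * Ad \<in> carrier_mat m n" "P * Ad * Q \<in> carrier_mat m n" using Ad pr(1,2) by auto
    have "dmult (dmult (As, Ad) Y) (As, Ad) = (As, P * Ad + 0\<^sub>m m m * As)"
      unfolding AY W0 by (simp add: dmult_def pr(3))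
    also have "\<dots> = (As, P * Ad)"
      using A cP by (simp add: mat_zero_mult_dim)
    \<comment> \<open>Under the conditions the last two terms cancel, so the essential part has
      infinitesimal part \<open>P * Ad\<close>.\<close>
    also have "P * Ad = P * Ad + Ad * Q - P * Ad * Q"
      unfolding conjunct2[OF H] using cP Ad pr(1,2) by (intro eq_matI) (auto simp del: index_mult_mat(1))
    finally have e1: "dmult (dmult (As, Ad) Y) (As, Ad) = ess_formula (As, Ad)"
      by (simp add: ess_formula_def Let_def G_def P_def Q_def)
    have "Q * - (G * Ad * G) + 0\<^sub>m n n * G = - (G * Ad * G)"
      using Ad G(1) pr(2) QQ[of "Ad * G" m] by (simp add: mat_dim_simps)
    then have e2: "dmult (dmult Y (As, Ad)) Y = Y"
      unfolding YA Z0 by (simp add: dmult_def Y_def pr(5))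
    have "penrose_dual m n (As, Ad) (ess_formula (As, Ad)) Y"
      unfolding penrose_dual_def using e1 e2 pr(9,10) A Ad G(1)
      by (simp add: AY YA W0 Z0 dtrans_def) (simp add: Y_def dcarrier_def)
    then show "gmpi (As, Ad) = mpdgi (As, Ad)"
      using gmpi_penrose(2)[OF B] Y by simp
  qed
qed

theorem theorem5p4:
  fixes As Ad :: "real mat" and m n :: nat
  assumes "As \<in> carrier_mat m n" and "Ad \<in> carrier_mat m n"
  shows "(gmpi (As, Ad) = mpdgi (As, Ad) \<longleftrightarrow>
           ((As * mp_inv As) * Ad * (1\<^sub>m n - mp_inv As * As) = 0\<^sub>m m n \<and>
            (1\<^sub>m m - As * mp_inv As) * Ad * (mp_inv As * As) = 0\<^sub>m m n)) \<and>
         mpdgi (As, Ad) =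
           gmpi (As, Ad - (As * mp_inv As) * Ad * (1\<^sub>m n - mp_inv As * As)
                        - (1\<^sub>m m - As * mp_inv As) * Ad * (mp_inv As * As))"
proof -
  define G where "G = mp_inv As"
  define P where "P = As * G"
  define Q where "Q = G * As"
  note G = mp_inv_penrose(1)[OF assms(1), folded G_def]
  note pr = mp_inv_projectors[OF assms(1), folded G_def, folded P_def Q_def]
  note iff = gmpi_eq_mpdgi_iff[OF assms(1), folded G_def, folded P_def Q_def]
  define A2 where "A2 = Ad - P * Ad * (1\<^sub>m n - Q) - (1\<^sub>m m - P) * Ad * Q"
  have c: "P * Ad \<in> carrier_mat m n" "P * Ad * Q \<in> carrier_mat m n" "Ad * Q \<in> carrier_mat m n"
    using assms pr(1,2) by auto
  have ar: "X0 - (X1 - X3) - (X2 - X3) = X0 - X1 - X2 + (X3 + X3)"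
    if "X0 \<in> carrier_mat m n" "X1 \<in> carrier_mat m n" "X2 \<in> carrier_mat m n" "X3 \<in> carrier_mat m n"
    for X0 X1 X2 X3 :: "real mat"
    using that by (intro eq_matI) auto
  have "A2 = Ad - (P * Ad - P * Ad * Q) - (Ad * Q - P * Ad * Q)"
    unfolding A2_def using assms(2) pr(1,2) by (simp add: mat_dim_simps)
  also have "\<dots> = Ad - P * Ad - Ad * Q + (P * Ad * Q + P * Ad * Q)"
    by (rule ar[OF assms(2) c(1,3,2)])
  finally have A2: "A2 = Ad - P * Ad - Ad * Q + (P * Ad * Q + P * Ad * Q)" .
  have cA2: "A2 \<in> carrier_mat m n" unfolding A2 using assms(2) c by auto
  have PP: "P * (P * X) = P * X" if "X \<in> carrier_mat m k" for X k
    using that pr(1,7) by (simp add: mat_assoc_dim[symmetric])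
  have GP: "G * (P * X) = G * X" if "X \<in> carrier_mat m k" for X k
    using that G pr(1,6) by (simp add: mat_assoc_dim[symmetric])
  have cAQ: "Ad * Q \<in> carrier_mat m n" by (rule c(3))
  \<comment> \<open>The standard part is unchanged, hence so are \<open>P\<close> and
    \<open>Q\<close>. The products \<open>P * A2\<close>, \<open>A2 * Q\<close> and
    \<open>P * A2 * Q\<close> all collapse to \<open>P * (Ad * Q)\<close>, so the criterion holds
    for \<open>A2\<close>.\<close>
  have "P * A2 = P * Ad - P * Ad - P * (Ad * Q) + (P * (Ad * Q) + P * (Ad * Q))"
    unfolding A2 using assms(2) pr(1,2) by (simp add: mat_dim_simps PP[OF assms(2)] PP[OF cAQ])
  also have "\<dots> = P * (Ad * Q)"
    using assms(2) pr(1,2) by (intro eq_matI) (auto simp del: index_mult_mat(1))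
  finally have PA2: "P * A2 = P * (Ad * Q)" .
  have "A2 * Q = Ad * Q - P * (Ad * Q) - Ad * Q + (P * (Ad * Q) + P * (Ad * Q))"
    unfolding A2 using assms(2) pr(1,2,8) by (simp add: mat_dim_simps)
  also have "\<dots> = P * (Ad * Q)"
    using assms(2) pr(1,2) by (intro eq_matI) (auto simp del: index_mult_mat(1))
  finally have A2Q: "A2 * Q = P * (Ad * Q)" .
  have PA2Q: "P * A2 * Q = P * (Ad * Q)"
    unfolding PA2 using assms(2) pr(1,2,8) by (simp add: mat_assoc_dim)
  \<comment> \<open>The removed blocks vanish between two factors \<open>G\<close>, because
    \<open>G * P = G\<close> and \<open>Q * G = G\<close>; the MPDGI does not see them.\<close>
  have "G * A2 * G = G * (P * A2) * G"
    using GP[OF cA2] by simp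
  also have "\<dots> = G * (Ad * (Q * G))"
    unfolding PA2 GP[OF cAQ] using assms(2) G pr(2) by (simp add: mat_assoc_dim)
  also have "\<dots> = G * Ad * G"
    unfolding pr(5) using assms(2) G by (simp add: mat_assoc_dim)
  finally have "mpdgi (As, A2) = mpdgi (As, Ad)"
    by (simp add: mpdgi_def G_def)
  moreover have "gmpi (As, A2) = mpdgi (As, A2)"
    using iff[OF cA2] PA2 A2Q PA2Q by simp
  ultimately have "mpdgi (As, Ad) = gmpi (As, A2)" by simp
  then show ?thesis
    using iff[OF assms(2)] projector_conditions_iff[OF pr(1,2) assms(2)]
    unfolding A2_def P_def Q_def G_def by blast
qed

end
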